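(* For each $n$ let $\mathrm{BCM}_n=\mathrm{BCM}(\boldsymbol d^{l},\boldsymbol d^{r})$ be the bipartite configuration model with degree sequences $\boldsymbol d^l=(d^l_v)_{v\in\mathscr V^l}$, $\boldsymbol d^r=(d^r_a)_{a\in\mathscr V^r}$. Assume that, as $n\to\infty$, $D_n^l\to D^l$ and $D_n^r\to D^r$ in distribution, $\mathbb E[D_n^l]\to\mathbb E[D^l]<\infty$ and $\mathbb E[D_n^r]\to\mathbb E[D^r]<\infty$. Let $V_n^{b}$ be uniform on $\mathscr V^l\cup\mathscr V^r$, independent of the matching. Then, as $n\to\infty$, $(\mathrm{BCM}_n,V_n^b)$ converges in probability in the local weak sense to $(\mathrm{BP}_s,\underline 0)$, the mixture of two branching process trees defined in the context; i.e. for every fixed rooted graph $(G,o)$ and every $r\in\{0,1,2,\dots\}$, $$\frac1{N_n+M_n}\sum_{u\in\mathscr V^l\cup\mathscr V^r}\mathbf 1_{\{B_r(\mathrm{BCM}_n,u)\simeq B_r(G,o)\}}\ \xrightarrow{\ \mathbb P\ }\ \mathbb P\big(B_r(\mathrm{BP}_s,\underline 0)\simeq B_r(G,o)\big).$$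
   Context: **Bipartite configuration model.** For each $n$, $\mathscr V^l$ and $\mathscr V^r$ are disjoint vertex sets of sizes $N_n\to\infty$ and $M_n\to\infty$. Each $v\in\mathscr V^l$ has degree $d^l_v\ge1$ and each $a\in\mathscr V^r$ has degree $d^r_a\ge1$ (integers), with $h_n:=\sum_{v\in\mathscr V^l}d^l_v=\sum_{a\in\mathscr V^r}d^r_a$. Attach $d^l_v$ half-edges to each $v\in\mathscr V^l$ and $d^r_a$ half-edges to each $a\in\mathscr V^r$, and take a uniformly random bijection $\omega_n$ between the $l$-half-edges and the $r$-half-edges. $\mathrm{BCM}(\boldsymbol d^l,\boldsymbol d^r)$ is the bipartite multigraph on $\mathscr V^l\cup\mathscr V^r$ with one edge between $v$ and $a$ for each matched pair of a half-edge at $v$ and a half-edge at $a$. $D_n^l$ is the degree of a uniform vertex of $\mathscr V^l$ and $D_n^r$ the degree of a uniform vertex of $\mathscr V^r$. **Local convergence.** A rooted graph is a locally finite connected (multi)graph with a distinguished vertex; if a vertex of a disconnected graph is taken as root, one restricts to its connected component. $\simeq$ is graph isomorphism mapping root to root. $B_r(G,o)$ is the subgraph of $G$ spanned by the vertices at graph distance at most $r$ from $o$, rooted at $o$. **Limit.** For an $\mathbb N$-valued $X$ with finite positive mean, $\widetilde X$ has pmf $\mathbb P(\widetilde X=k)=(k+1)\mathbb P(X=k+1)/\mathbb E[X]$, $k\ge0$. $\mathrm{BP}_l$ is the family tree (rooted at $\underline 0$) of a discrete-time branching process with independent offspring in which the root has offspring distributed as $D^l$, vertices in odd generations have offspring distributed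 as $\widetilde D^r$, and vertices in even generations $\ge2$ have offspring distributed as $\widetilde D^l$. $\mathrm{BP}_r$ is defined in the same way with the roles of $l$ and $r$ reversed. With $\gamma=\mathbb E[D^l]/\mathbb E[D^r]$, $(\mathrm{BP}_s,\underline 0)$ is the mixture that equals $(\mathrm{BP}_l,\underline 0)$ with probability $1/(1+\gamma)$ and $(\mathrm{BP}_r,\underline 0)$ with probability $\gamma/(1+\gamma)$. *)

theory Defs
  imports "HOL-Probability.Probability" "HOL-Library.Uprod"
begin

text \<open>Edges are objects of their own, so parallel edges are allowed; a loop at \<open>x\<close> is an edge with
  end pair \<open>Upair x x\<close>.\<close>

record ('v, 'e) mgraph =
  verts :: "'v set"
  edges :: "'e set"
  ends :: "'e \<Rightarrow> 'v uprod"

definition mgraph :: "('v, 'e) mgraph \<Rightarrow> bool" where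
  "mgraph G \<longleftrightarrow> (\<forall>e\<in>edges G. set_uprod (ends G e) \<subseteq> verts G)"

definition adj :: "('v, 'e) mgraph \<Rightarrow> ('v \<times> 'v) set" where
  "adj G = {(x, y). \<exists>e\<in>edges G. ends G e = Upair x y}"

definition gdist :: "('v, 'e) mgraph \<Rightarrow> 'v \<Rightarrow> 'v \<Rightarrow> enat" where
  "gdist G x y = (INF k\<in>{k. (x, y) \<in> adj G ^^ k}. enat k)"

definition locally_finite_mgraph :: "('v, 'e) mgraph \<Rightarrow> bool" where
  "locally_finite_mgraph G \<longleftrightarrow> (\<forall>x\<in>verts G. finite {e\<in>edges G. x \<in> set_uprod (ends G e)})"

definition connected_mgraph :: "('v, 'e) mgraph \<Rightarrow> bool" where
  "connected_mgraph G \<longleftrightarrow> (\<forall>x\<in>verts G. \<forall>y\<in>verts G. gdist G x y < \<infinity>)"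

text \<open>A graph with a root is a pair of a multigraph and a vertex.\<close>

definition rooted_graph :: "('v, 'e) mgraph \<times> 'v \<Rightarrow> bool" where
  "rooted_graph = (\<lambda>(G, \<rho>). mgraph G \<and> locally_finite_mgraph G \<and> connected_mgraph G \<and> \<rho> \<in> verts G)"

definition rooted_iso :: "('v, 'e) mgraph \<times> 'v \<Rightarrow> ('w, 'f) mgraph \<times> 'w \<Rightarrow> bool"
  (infix \<open>\<simeq>\<close> 50) where
  "rooted_iso = (\<lambda>(G, \<rho>) (H, \<sigma>). \<exists>\<phi> \<psi>.
     bij_betw \<phi> (verts G) (verts H) \<and> bij_betw \<psi> (edges G) (edges H) \<and>
     (\<forall>e\<in>edges G. ends H (\<psi> e) = map_uprod \<phi> (ends G e)) \<and> \<phi> \<rho> = \<sigma>)"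

definition induced_subgraph :: "('v, 'e) mgraph \<Rightarrow> 'v set \<Rightarrow> ('v, 'e) mgraph" where
  "induced_subgraph G S =
     \<lparr>verts = verts G \<inter> S, edges = {e\<in>edges G. set_uprod (ends G e) \<subseteq> S}, ends = ends G\<rparr>"

text \<open>Vertices in another component than the root are at distance \<open>\<infinity>\<close>, so the ball of a vertex of a
  disconnected graph is the ball in its connected component.\<close>

definition rooted_ball :: "nat \<Rightarrow> ('v, 'e) mgraph \<times> 'v \<Rightarrow> ('v, 'e) mgraph \<times> 'v" where
  "rooted_ball r = (\<lambda>(G, \<rho>). (induced_subgraph G {x\<in>verts G. gdist G \<rho> x \<le> enat r}, \<rho>))"

definition half_edges :: "'v set \<Rightarrow> ('v \<Rightarrow> nat) \<Rightarrow> ('v \<times> nat) set" where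
  "half_edges V d = (SIGMA v:V. {..<d v})"

text \<open>Matchings are taken extensional, so that they correspond one-to-one to the bijections between
  the two sets of half-edges.\<close>

definition matchings ::
  "'v set \<Rightarrow> ('v \<Rightarrow> nat) \<Rightarrow> 'v set \<Rightarrow> ('v \<Rightarrow> nat) \<Rightarrow> ('v \<times> nat \<Rightarrow> 'v \<times> nat) set" where
  "matchings Vl dl Vr dr =
     {\<omega> \<in> extensional (half_edges Vl dl). bij_betw \<omega> (half_edges Vl dl) (half_edges Vr dr)}"

text \<open>A matched pair of half-edges is represented by its member on the left side.\<close>

definition config_graph ::
  "'v set \<Rightarrow> ('v \<Rightarrow> nat) \<Rightarrow> 'v set \<Rightarrow> ('v \<times> nat \<Rightarrow> 'v \<times> nat) \<Rightarrow> ('v, 'v \<times> nat) mgraph" where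
  "config_graph Vl dl Vr \<omega> =
     \<lparr>verts = Vl \<union> Vr, edges = half_edges Vl dl, ends = (\<lambda>h. Upair (fst h) (fst (\<omega> h)))\<rparr>"

definition BCM ::
  "'v set \<Rightarrow> ('v \<Rightarrow> nat) \<Rightarrow> 'v set \<Rightarrow> ('v \<Rightarrow> nat) \<Rightarrow> ('v, 'v \<times> nat) mgraph pmf" where
  "BCM Vl dl Vr dr = map_pmf (config_graph Vl dl Vr) (pmf_of_set (matchings Vl dl Vr dr))"

definition unif_degree :: "'v set \<Rightarrow> ('v \<Rightarrow> nat) \<Rightarrow> nat pmf" where
  "unif_degree V d = map_pmf d (pmf_of_set V)"

definition weak_conv_nat :: "(nat \<Rightarrow> nat pmf) \<Rightarrow> nat pmf \<Rightarrow> bool" where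
  "weak_conv_nat D_seq D \<longleftrightarrow>
     weak_conv_m (\<lambda>n. distr (measure_pmf (D_seq n)) borel real) (distr (measure_pmf D) borel real)"

definition tendsto_in_prob :: "(nat \<Rightarrow> 'a pmf) \<Rightarrow> (nat \<Rightarrow> 'a \<Rightarrow> real) \<Rightarrow> real \<Rightarrow> bool" where
  "tendsto_in_prob p X c \<longleftrightarrow>
     (\<forall>\<epsilon>>0. (\<lambda>n. measure_pmf.prob (p n) {x. \<bar>X n x - c\<bar> > \<epsilon>}) \<longlonglongrightarrow> 0)"

abbreviation pmf_mean :: "nat pmf \<Rightarrow> real" where
  "pmf_mean D \<equiv> measure_pmf.expectation D real"

text \<open>Meaningful for laws with finite positive mean only.\<close>

definition size_biased :: "nat pmf \<Rightarrow> nat pmf" where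
  "size_biased D = embed_pmf (\<lambda>k. real (k + 1) * pmf D (k + 1) / pmf_mean D)"

text \<open>Ulam--Harris encoding: potential individuals are finite words over the naturals, the root
  is the empty word, the children of \<open>u\<close> are the words \<open>u @ [i]\<close> with \<open>i < \<xi> u\<close>, where \<open>\<xi> u\<close> is the
  number of children of \<open>u\<close>. The edge joining an individual to its parent is named after the
  individual.\<close>

definition family_tree :: "(nat list \<Rightarrow> nat) \<Rightarrow> (nat list, nat list) mgraph" where
  "family_tree \<xi> = (let T = {u. \<forall>k<length u. u ! k < \<xi> (take k u)} in
     \<lparr>verts = T, edges = T - {[]}, ends = (\<lambda>u. Upair (butlast u) u)\<rparr>)"

definition offspring_law :: "nat pmf \<Rightarrow> nat pmf \<Rightarrow> nat \<Rightarrow> nat pmf" where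
  "offspring_law D D' g =
     (if g = 0 then D else if odd g then size_biased D' else size_biased D)"

text \<open>The joint law of the independent offspring numbers; \<open>D\<close> belongs to the side of the root.\<close>

definition BP :: "nat pmf \<Rightarrow> nat pmf \<Rightarrow> (nat list \<Rightarrow> nat) measure" where
  "BP D D' = (\<Pi>\<^sub>M u\<in>UNIV. measure_pmf (offspring_law D D' (length u)))"

definition BP_l :: "nat pmf \<Rightarrow> nat pmf \<Rightarrow> (nat list \<Rightarrow> nat) measure" where
  "BP_l Dl Dr = BP Dl Dr"

definition BP_r :: "nat pmf \<Rightarrow> nat pmf \<Rightarrow> (nat list \<Rightarrow> nat) measure" where
  "BP_r Dl Dr = BP Dr Dl"

definition BP_s :: "nat pmf \<Rightarrow> nat pmf \<Rightarrow> (nat list \<Rightarrow> nat) measure" where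
  "BP_s Dl Dr = (let \<gamma> = pmf_mean Dl / pmf_mean Dr in
     measure_pmf (bernoulli_pmf (\<gamma> / (1 + \<gamma>))) \<bind>
       (\<lambda>from_right. if from_right then BP_r Dl Dr else BP_l Dl Dr))"

end

theory Submission
  imports Defs "HOL-Real_Asymp.Real_Asymp"
begin

text \<open>Half-edges are numbered, so exploring the neighbourhood of a vertex yields an ordered tree, and
  it is enough to count, for each ordered tree \<open>t\<close> of depth \<open>r\<close>, the vertices whose exploration
  is exactly \<open>t\<close>. Such a vertex corresponds to a unique injective placement of the nodes of \<open>t\<close> whose
  half-edges are matched as \<open>t\<close> prescribes. A prescribed set of \<open>m\<close> pairs is matched with probability
  \<open>(h - m)! / h!\<close>, which yields the first moment; for the second moment, disjoint placements decouple, and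
  overlapping ones are few because all degrees in an occurrence of \<open>t\<close> are bounded. Chebyshev's inequality gives
  convergence of the frequency of \<open>t\<close> to its probability under the branching process. These
  probabilities sum to 1 over the countably many \<open>t\<close>, so finitely many of them carry all but
  \<open>\<epsilon>\<close> of the mass: vertices whose ball contains a cycle are negligible without any separate
  estimate, and the frequency of an isomorphism class is squeezed between sums over finitely many \<open>t\<close>.\<close>

section \<open>Bijections extending a partial matching\<close>

text \<open>Only the mean degrees are assumed to converge, so second moments of the degrees may
  diverge and cannot be used to control short cycles. This is why every estimate concerns one fixed
  tree, with its degrees prescribed.

  Working with ordered trees instead of isomorphism classes leaves no automorphisms to divide out,
  and the number of placements, before injectivity is imposed, is an exact product over the nodes.
  The root contributes the number of vertices of the right degree. Any other node with
  \<open>k\<close> children contributes \<open>k + 1\<close> times the number of vertices of degree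
  \<open>k + 1\<close>: a vertex, and the half-edge of it that leads to the parent. Divided by the
  number \<open>h\<close> of half-edges, this count is the source of the size-biased law, while each
  coincidence of two vertices costs a factor of order \<open>1 / h\<close>.

  The mixture weights arise because \<open>h\<close> is common to both sides: \<open>h / N_n\<close>
  and \<open>h / M_n\<close> tend to the two mean degrees, which fixes the limiting proportions of
  the sides.\<close>

lemma card_bijections:
  assumes "finite A" "finite B" "card A = card B"
  shows "card {f \<in> extensional A. bij_betw f A B} = fact (card A)"
proof -
  have "f ` A = B" if "f ` A \<subseteq> B" "inj_on f A" for f
    using that assms card_subset_eq[of B "f ` A"] card_image[of f A] by simp
  then have *: "{f \<in> extensional A. bij_betw f A B} = {f \<in> A \<rightarrow>\<^sub>E B. inj_on f A}"
    unfolding bij_betw_def PiE_def Pi_iff by (auto simp: image_subset_iff)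
  have "(\<Prod>i=0..<n. n - i) = (fact n :: nat)" for n
    by (simp add: fact_prod_rev)
  then show ?thesis
    unfolding * using card_inj_on_subset_funcset[of A B A] assms by simp
qed

text \<open>Induction on \<open>P\<close>: setting the value at \<open>a\<close> to \<open>c\<close>
  is a bijection from the extensions of \<open>P\<close> on the sets without \<open>a\<close> and
  \<open>c\<close> to the extensions of \<open>insert p P\<close>. Injectivity of both projections
  keeps the remaining pairs away from \<open>a\<close> and \<open>c\<close>.\<close>

lemma card_bijections_extending:
  assumes "finite A" "finite B" "card A = card B"
    and "P \<subseteq> A \<times> B" "inj_on fst P" "inj_on snd P"
  shows "card {f \<in> extensional A. bij_betw f A B \<and> (\<forall>(a, c)\<in>P. f a = c)} = fact (card A - card P)"
proof -
  have "finite P" using assms finite_subset by blast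
  then show ?thesis using assms
  proof (induction P arbitrary: A B rule: finite_induct)
    case empty
    then show ?case using card_bijections[of A B] by simp
  next
    case (insert p P)
    obtain a c where p: "p = (a, c)" by force
    have ac: "a \<in> A" "c \<in> B" using insert p by auto
    have "x \<noteq> a \<and> y \<noteq> c" if "(x, y) \<in> P" for x y
      using inj_onD[OF insert.prems(5), of "(x, y)" p] inj_onD[OF insert.prems(6), of "(x, y)" p]
        insert.hyps p that by auto
    then have P: "P \<subseteq> (A - {a}) \<times> (B - {c})"
      using insert.prems by blast
    let ?S = "\<lambda>A B P. {f \<in> extensional A. bij_betw f A B \<and> (\<forall>(a, c)\<in>P. f a = c)}"
    have bij: "bij_betw (\<lambda>g. g(a := c)) (?S (A - {a}) (B - {c}) P) (?S A B (insert p P))"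
    proof (rule bij_betwI[where g = "\<lambda>f. f(a := undefined)"])
      show "(\<lambda>g. g(a := c)) \<in> ?S (A - {a}) (B - {c}) P \<rightarrow> ?S A B (insert p P)"
      proof
        fix g assume g: "g \<in> ?S (A - {a}) (B - {c}) P"
        have "bij_betw (g(a := c)) (insert a (A - {a})) (insert c (B - {c}))"
          using g notIn_Un_bij_betw[of a "A - {a}" "g(a := c)" "B - {c}"]
            bij_betw_cong[of "A - {a}" "g(a := c)" g] by auto
        then show "g(a := c) \<in> ?S A B (insert p P)"
          using g P ac p by (auto simp: insert_absorb extensional_def)
      qed
      show "(\<lambda>f. f(a := undefined)) \<in> ?S A B (insert p P) \<rightarrow> ?S (A - {a}) (B - {c}) P"
      proof
        fix f assume f: "f \<in> ?S A B (insert p P)"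
        have "bij_betw f (A - {a}) (B - {c})"
          using f ac p bij_betw_DiffI[of f A B "{a}" "{c}"] by (auto simp: bij_betw_singleton_iff)
        then have "bij_betw (f(a := undefined)) (A - {a}) (B - {c})"
          using bij_betw_cong[of "A - {a}" "f(a := undefined)" f] by auto
        then show "f(a := undefined) \<in> ?S (A - {a}) (B - {c}) P"
          using f P by (auto simp: extensional_def)
      qed
    qed (auto simp: p extensional_def fun_eq_iff)
    have "card (?S A B (insert p P)) = card (?S (A - {a}) (B - {c}) P)"
      using bij_betw_same_card[OF bij] by simp
    also have "\<dots> = fact (card (A - {a}) - card P)"
      using insert.prems ac P by (intro insert.IH) auto
    also have "\<dots> = fact (card A - card (insert p P))"
      using insert ac by simp
    finally show ?case .
  qed
qed

lemma finite_matchings: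
  assumes "finite Vl" "finite Vr" shows "finite (matchings Vl dl Vr dr)"
proof -
  have "matchings Vl dl Vr dr \<subseteq> half_edges Vl dl \<rightarrow>\<^sub>E half_edges Vr dr"
    unfolding matchings_def bij_betw_def by (blast intro: PiE_I extensional_arb)
  then show ?thesis
    using assms by (rule_tac finite_subset) (auto simp: half_edges_def intro!: finite_PiE)
qed

lemma card_half_edges: "finite V \<Longrightarrow> card (half_edges V d) = (\<Sum>v\<in>V. d v)"
  by (simp add: half_edges_def)

lemma card_matchings_extending:
  assumes "finite Vl" "finite Vr" "(\<Sum>v\<in>Vl. dl v) = (\<Sum>a\<in>Vr. dr a)"
    and "P \<subseteq> half_edges Vl dl \<times> half_edges Vr dr" "inj_on fst P" "inj_on snd P"
  shows "card {\<omega> \<in> matchings Vl dl Vr dr. \<forall>(a, c)\<in>P. \<omega> a = c} = fact ((\<Sum>v\<in>Vl. dl v) - card P)"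
proof -
  have "finite (half_edges Vl dl)" "finite (half_edges Vr dr)"
    using assms by (auto simp: half_edges_def)
  moreover have "card (half_edges Vl dl) = card (half_edges Vr dr)"
    using assms by (simp add: card_half_edges)
  ultimately show ?thesis
    using card_bijections_extending[OF _ _ _ assms(4-6)] assms(1)
    by (simp add: matchings_def card_half_edges conj_assoc)
qed

section \<open>Balls in multigraphs and in family trees\<close>

text \<open>The inverse maps work only on the carriers: \<open>mgraph\<close> puts the ends of every
  edge among the vertices, where \<open>inv_into\<close> undoes \<phi>, and the root has to lie
  there for the same reason.\<close>

lemma rooted_iso_sym:
  assumes "mgraph (fst X)" "X \<simeq> Y" "snd X \<in> verts (fst X)" shows "Y \<simeq> X"
proof -
  obtain G g H h where X: "X = (G, g)" and Y: "Y = (H, h)" by (metis surj_pair)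
  from assms obtain \<phi> \<psi> where
    bij: "bij_betw \<phi> (verts G) (verts H)" "bij_betw \<psi> (edges G) (edges H)" and
    ends: "\<And>e. e \<in> edges G \<Longrightarrow> ends H (\<psi> e) = map_uprod \<phi> (ends G e)" and
    root: "\<phi> g = h" and g: "\<And>e. e \<in> edges G \<Longrightarrow> set_uprod (ends G e) \<subseteq> verts G"
    unfolding X Y rooted_iso_def mgraph_def by auto
  have "ends G (inv_into (edges G) \<psi> f) = map_uprod (inv_into (verts G) \<phi>) (ends H f)"
    if f: "f \<in> edges H" for f
  proof -
    let ?e = "inv_into (edges G) \<psi> f"
    have e: "?e \<in> edges G" "\<psi> ?e = f"
      using f bij(2) by (auto simp: bij_betw_def inv_into_into f_inv_into_f)
    have "map_uprod (inv_into (verts G) \<phi> \<circ> \<phi>) (ends G ?e) = ends G ?e"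
      using g[OF e(1)] bij(1) by (intro uprod.map_ident_strong) (auto simp: bij_betw_def)
    then show ?thesis
      using ends[OF e(1)] e(2) by (simp add: uprod.map_comp)
  qed
  moreover have "inv_into (verts G) \<phi> h = g"
    using root bij(1) assms(3) by (auto simp: X bij_betw_def)
  ultimately show ?thesis
    unfolding X Y rooted_iso_def prod.case using bij
    by (intro exI[of _ "inv_into (verts G) \<phi>"] exI[of _ "inv_into (edges G) \<psi>"])
      (simp add: bij_betw_inv_into)
qed

lemma rooted_iso_trans:
  assumes "X \<simeq> Y" "Y \<simeq> Z" shows "X \<simeq> Z"
proof -
  obtain G g H h K k where X: "X = (G, g)" and Y: "Y = (H, h)" and Z: "Z = (K, k)"
    by (metis surj_pair)
  from assms obtain \<phi> \<psi> \<phi>' \<psi>' where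
    "bij_betw \<phi> (verts G) (verts H)" "bij_betw \<psi> (edges G) (edges H)"
    "\<forall>e\<in>edges G. ends H (\<psi> e) = map_uprod \<phi> (ends G e)" "\<phi> g = h"
    "bij_betw \<phi>' (verts H) (verts K)" "bij_betw \<psi>' (edges H) (edges K)"
    "\<forall>e\<in>edges H. ends K (\<psi>' e) = map_uprod \<phi>' (ends H e)" "\<phi>' h = k"
    unfolding X Y Z rooted_iso_def by auto
  then have "bij_betw (\<phi>' \<circ> \<phi>) (verts G) (verts K) \<and> bij_betw (\<psi>' \<circ> \<psi>) (edges G) (edges K) \<and>
     (\<forall>e\<in>edges G. ends K ((\<psi>' \<circ> \<psi>) e) = map_uprod (\<phi>' \<circ> \<phi>) (ends G e)) \<and> (\<phi>' \<circ> \<phi>) g = k"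
    by (auto simp: uprod.map_comp bij_betw_apply intro: bij_betw_trans)
  then show ?thesis
    unfolding X Z rooted_iso_def prod.case by (intro exI)
qed

lemma gdist_le_iff: "gdist G x y \<le> enat r \<longleftrightarrow> (\<exists>k\<le>r. (x, y) \<in> adj G ^^ k)"
proof -
  let ?A = "{k. (x, y) \<in> adj G ^^ k}"
  show ?thesis
  proof (cases "?A = {}")
    case False
    then have "Inf (enat ` ?A) \<in> enat ` ?A"
      by (meson Inf_enat_def image_is_empty wellorder_InfI ex_in_conv)
    then obtain k where "Inf (enat ` ?A) = enat k" "(x, y) \<in> adj G ^^ k" by auto
    moreover have "Inf (enat ` ?A) \<le> enat j" if "(x, y) \<in> adj G ^^ j" for j
      by (rule INF_lower) (simp add: that)
    ultimately show ?thesis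
      unfolding gdist_def using order_trans[of "Inf (enat ` ?A)" _ "enat r"] by (metis enat_ord_simps(1))
  qed (auto simp: gdist_def top_enat_def)
qed

text \<open>Replaces distances by a recursion over layers, for family trees and configuration graphs
  alike. The recursion is asked for only below \<open>r\<close>, since an embedded tree of depth
  \<open>r\<close> says nothing about later layers.\<close>

lemma gdist_ball_eq:
  assumes "L 0 = {\<rho>}" "\<And>k. k < r \<Longrightarrow> L (Suc k) = L k \<union> adj G `` L k"
  shows "{x. gdist G \<rho> x \<le> enat r} = L r"
proof -
  have "{x. \<exists>j\<le>k. (\<rho>, x) \<in> adj G ^^ j} = L k" if "k \<le> r" for k
    using that
  proof (induction k)
    case (Suc k)
    have "{x. \<exists>j\<le>Suc k. (\<rho>, x) \<in> adj G ^^ j} =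
      {x. \<exists>j\<le>k. (\<rho>, x) \<in> adj G ^^ j} \<union> adj G `` {x. \<exists>j\<le>k. (\<rho>, x) \<in> adj G ^^ j}"
    proof (intro set_eqI iffI)
      fix x assume "x \<in> {x. \<exists>j\<le>Suc k. (\<rho>, x) \<in> adj G ^^ j}"
      then obtain j where j: "j \<le> Suc k" "(\<rho>, x) \<in> adj G ^^ j" by auto
      show "x \<in> {x. \<exists>j\<le>k. (\<rho>, x) \<in> adj G ^^ j} \<union> adj G `` {x. \<exists>j\<le>k. (\<rho>, x) \<in> adj G ^^ j}"
        using j by (cases "j = Suc k") (auto simp: le_Suc_eq)
    next
      fix x assume "x \<in> {x. \<exists>j\<le>k. (\<rho>, x) \<in> adj G ^^ j} \<union> adj G `` {x. \<exists>j\<le>k. (\<rho>, x) \<in> adj G ^^ j}"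
      then consider j where "j \<le> k" "(\<rho>, x) \<in> adj G ^^ j"
        | j y where "j \<le> k" "(\<rho>, y) \<in> adj G ^^ j" "(y, x) \<in> adj G" by auto
      then show "x \<in> {x. \<exists>j\<le>Suc k. (\<rho>, x) \<in> adj G ^^ j}"
      proof cases
        case 2
        then have "(\<rho>, x) \<in> adj G ^^ Suc j" by auto
        then show ?thesis using 2(1) by (intro CollectI exI[of _ "Suc j"]) auto
      qed (auto intro: le_SucI)
    qed
    then show ?case using Suc assms(2) by auto
  qed (use assms(1) in auto)
  then show ?thesis by (simp add: gdist_le_iff)
qed

section \<open>Finite truncations of family trees\<close>

definition nodes :: "nat \<Rightarrow> (nat list \<Rightarrow> nat) \<Rightarrow> nat list set" where
  "nodes r \<xi> = {u. length u \<le> r \<and> (\<forall>k<length u. u ! k < \<xi> (take k u))}"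

text \<open>Offspring numbers are kept also for the nodes of depth exactly \<open>r\<close>. The ball of radius \<open>r\<close> does not
  depend on them, but this bounds the degrees of all vertices involved.\<close>

definition trunc :: "nat \<Rightarrow> (nat list \<Rightarrow> nat) \<Rightarrow> nat list \<Rightarrow> nat" where
  "trunc r \<xi> = (\<lambda>w. if w \<in> nodes r \<xi> then \<xi> w else 0)"

lemma Nil_in_nodes [simp]: "[] \<in> nodes r \<xi>"
  by (simp add: nodes_def)

lemma snoc_in_nodes: "w @ [i] \<in> nodes r \<xi> \<longleftrightarrow> length w < r \<and> w \<in> nodes r \<xi> \<and> i < \<xi> w"
  by (auto simp: nodes_def less_Suc_eq nth_append)

lemma nodes_cases:
  assumes "w \<in> nodes r \<xi>"
  obtains "w = []" | p i where "w = p @ [i]" "length p < r" "p \<in> nodes r \<xi>" "i < \<xi> p"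
  using assms by (cases w rule: rev_cases) (auto simp: snoc_in_nodes)

lemma nodes_induct [consumes 1, case_names Nil snoc]:
  assumes "w \<in> nodes r \<xi>" and "P []"
    and "\<And>w i. w \<in> nodes r \<xi> \<Longrightarrow> length w < r \<Longrightarrow> i < \<xi> w \<Longrightarrow> P w \<Longrightarrow> P (w @ [i])"
  shows "P w"
  using assms(1) by (induction w rule: rev_induct) (auto simp: snoc_in_nodes assms(2,3))

lemma butlast_in_nodes: "w \<in> nodes r \<xi> \<Longrightarrow> butlast w \<in> nodes r \<xi>"
  by (erule nodes_cases) auto

lemma nodes_Suc: "nodes (Suc r) \<xi> = nodes r \<xi> \<union> (\<Union>w\<in>nodes r \<xi>. (\<lambda>i. w @ [i]) ` {..<\<xi> w})"
proof (intro set_eqI iffI)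
  fix w assume w: "w \<in> nodes (Suc r) \<xi>"
  then show "w \<in> nodes r \<xi> \<union> (\<Union>w\<in>nodes r \<xi>. (\<lambda>i. w @ [i]) ` {..<\<xi> w})"
  proof (cases rule: nodes_cases)
    case (2 p i)
    then have "p \<in> nodes r \<xi>" by (auto simp: nodes_def)
    then show ?thesis using 2 by blast
  qed simp
next
  fix w assume "w \<in> nodes r \<xi> \<union> (\<Union>w\<in>nodes r \<xi>. (\<lambda>i. w @ [i]) ` {..<\<xi> w})"
  then show "w \<in> nodes (Suc r) \<xi>"
    by (auto simp: snoc_in_nodes) (auto simp: nodes_def)
qed

lemma finite_nodes [simp]: "finite (nodes r \<xi>)"
proof (induction r)
  case 0
  have "nodes 0 \<xi> = {[]}" by (auto simp: nodes_def)
  then show ?case by simp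
qed (simp add: nodes_Suc)

lemma nodes_mono: "k \<le> r \<Longrightarrow> nodes k \<xi> \<subseteq> nodes r \<xi>"
  by (auto simp: nodes_def)

text \<open>Agreement propagates from generation to generation: membership of \<open>w @ [i]\<close>
  consults the offspring number of \<open>w\<close>, which is itself a node.\<close>

lemma nodes_cong:
  assumes "\<And>w. w \<in> nodes r \<xi> \<Longrightarrow> \<xi>' w = \<xi> w"
  shows "nodes r \<xi>' = nodes r \<xi>"
proof (rule set_eqI)
  fix w show "w \<in> nodes r \<xi>' \<longleftrightarrow> w \<in> nodes r \<xi>"
    using assms by (induction w rule: rev_induct) (auto simp: snoc_in_nodes)
qed

lemma nodes_trunc [simp]: "nodes r (trunc r \<xi>) = nodes r \<xi>"
  by (rule nodes_cong) (simp add: trunc_def)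

text \<open>Turns the event that the truncation is \<open>t\<close> into a cylinder over finitely
  many coordinates, whose probability under the branching process is a finite product.\<close>

lemma trunc_eq_iff:
  assumes "t \<in> range (trunc r)"
  shows "trunc r \<xi> = t \<longleftrightarrow> (\<forall>w\<in>nodes r t. \<xi> w = t w)"
proof
  assume eq: "\<forall>w\<in>nodes r t. \<xi> w = t w"
  then have nodes: "nodes r \<xi> = nodes r t" by (intro nodes_cong) simp
  obtain \<xi>0 where t: "t = trunc r \<xi>0" using assms by auto
  have "t w = 0" if "w \<notin> nodes r t" for w
    using that unfolding t nodes_trunc by (simp add: trunc_def)
  then show "trunc r \<xi> = t"
    using eq nodes unfolding trunc_def[of r \<xi>] by (intro ext) simp
next
  assume t: "trunc r \<xi> = t"
  show "\<forall>w\<in>nodes r t. \<xi> w = t w"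
    unfolding t[symmetric] nodes_trunc by (simp add: trunc_def)
qed

text \<open>A truncation has finite support and vanishes elsewhere, so it is encoded injectively by
  the finite set of its nonzero argument-value pairs.\<close>

lemma countable_range_trunc: "countable (range (trunc r))"
proof -
  let ?g = "\<lambda>f :: nat list \<Rightarrow> nat. (\<lambda>w. (w, f w)) ` {w. f w \<noteq> 0}"
  have "inj ?g"
  proof (rule injI)
    fix f h :: "nat list \<Rightarrow> nat" assume eq: "?g f = ?g h"
    have *: "f w = h w" if "f w \<noteq> 0" "?g f = ?g h" for f h :: "nat list \<Rightarrow> nat" and w
    proof -
      have "(w, f w) \<in> ?g f" using that(1) by blast
      then show ?thesis unfolding that(2) by auto
    qed
    show "f = h"
      using *[OF _ eq] *[OF _ eq[symmetric]] by (metis ext)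
  qed
  have "?g ` range (trunc r) \<subseteq> Collect finite"
  proof -
    have "{w. trunc r \<xi> w \<noteq> 0} \<subseteq> nodes r \<xi>" for \<xi> by (auto simp: trunc_def)
    then have "finite {w. trunc r \<xi> w \<noteq> 0}" for \<xi> by (rule finite_subset) simp
    then show ?thesis by auto
  qed
  then have "countable (?g ` range (trunc r))"
    using countable_Collect_finite countable_subset by blast
  then show ?thesis
    using \<open>inj ?g\<close> by (meson countable_image_inj_on inj_on_subset subset_UNIV)
qed

text \<open>Closed form of the ball in the family tree, with no distance left in it. It sees
  \<open>\<xi>\<close> only through \<open>nodes r \<xi>\<close>, which truncation
  preserves.\<close>

definition tree_ball :: "nat \<Rightarrow> (nat list \<Rightarrow> nat) \<Rightarrow> (nat list, nat list) mgraph \<times> nat list" where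
  "tree_ball r \<xi> = (\<lparr>verts = nodes r \<xi>, edges = nodes r \<xi> - {[]}, ends = (\<lambda>u. Upair (butlast u) u)\<rparr>, [])"

lemma mgraph_tree_ball: "mgraph (fst (tree_ball r \<xi>))"
  unfolding tree_ball_def mgraph_def by (simp add: butlast_in_nodes)

lemma tree_ball_trunc [simp]: "tree_ball r (trunc r \<xi>) = tree_ball r \<xi>"
  by (simp add: tree_ball_def)

text \<open>Every adjacency joins an individual to its parent, so the layers around the root are the
  generations.\<close>

lemma rooted_ball_family_tree: "rooted_ball r (family_tree \<xi>, []) = tree_ball r \<xi>"
proof -
  define T where "T = {u. \<forall>k<length u. u ! k < \<xi> (take k u)}"
  have nodes: "nodes k \<xi> = T \<inter> {u. length u \<le> k}" for k
    by (auto simp: nodes_def T_def)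
  have snoc: "w @ [i] \<in> T \<longleftrightarrow> w \<in> T \<and> i < \<xi> w" for w i
    by (auto simp: T_def less_Suc_eq nth_append)
  have Nil: "[] \<in> T" by (simp add: T_def)
  have ft: "family_tree \<xi> = \<lparr>verts = T, edges = T - {[]}, ends = (\<lambda>u. Upair (butlast u) u)\<rparr>"
    by (simp add: family_tree_def T_def Let_def)
  have adj: "(x, y) \<in> adj (family_tree \<xi>) \<longleftrightarrow>
      (x \<in> T \<and> x \<noteq> [] \<and> y = butlast x \<or> y \<in> T \<and> y \<noteq> [] \<and> x = butlast y)" for x y
    by (auto simp: adj_def ft)
  have "{x. gdist (family_tree \<xi>) [] x \<le> enat r} = nodes r \<xi>"
  proof (rule gdist_ball_eq)
    show "nodes 0 \<xi> = {[]}" by (auto simp: nodes_def)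
    fix k
    show "nodes (Suc k) \<xi> = nodes k \<xi> \<union> adj (family_tree \<xi>) `` nodes k \<xi>"
    proof (intro set_eqI iffI)
      fix w assume "w \<in> nodes (Suc k) \<xi>"
      then show "w \<in> nodes k \<xi> \<union> adj (family_tree \<xi>) `` nodes k \<xi>"
        by (cases rule: nodes_cases) (auto simp: nodes adj snoc Image_iff Nil)
    next
      fix w assume "w \<in> nodes k \<xi> \<union> adj (family_tree \<xi>) `` nodes k \<xi>"
      then consider "w \<in> nodes k \<xi>" | v where "v \<in> nodes k \<xi>" "(v, w) \<in> adj (family_tree \<xi>)"
        by auto
      then show "w \<in> nodes (Suc k) \<xi>"
      proof cases
        case 2
        from 2(2) obtain i where "v = w @ [i] \<or> w = v @ [i] \<and> w \<in> T"
          unfolding adj by (metis append_butlast_last_id)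
        then show ?thesis
          using 2(1) by (auto simp: nodes snoc)
      qed (auto simp: nodes_def)
    qed
  qed
  then have ball: "{x \<in> T. gdist (family_tree \<xi>) [] x \<le> enat r} = nodes r \<xi>"
    using nodes[of r] by blast
  have edges: "{e \<in> T - {[]}. set_uprod (Upair (butlast e) e) \<subseteq> nodes r \<xi>} = nodes r \<xi> - {[]}"
  proof (rule set_eqI)
    fix e
    show "e \<in> {e \<in> T - {[]}. set_uprod (Upair (butlast e) e) \<subseteq> nodes r \<xi>} \<longleftrightarrow> e \<in> nodes r \<xi> - {[]}"
      using butlast_in_nodes[of e] nodes[of r] unfolding set_uprod_simps by blast
  qed
  have T: "T \<inter> nodes r \<xi> = nodes r \<xi>" using nodes[of r] by blast
  have F: "verts (family_tree \<xi>) = T" "edges (family_tree \<xi>) = T - {[]}"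
    "ends (family_tree \<xi>) = (\<lambda>u. Upair (butlast u) u)" by (simp_all add: ft)
  show ?thesis
    unfolding rooted_ball_def induced_subgraph_def prod.case F ball T edges tree_ball_def ..
qed

section \<open>Embedded trees in the configuration model\<close>

lemma trunc_eq_0: "t \<in> range (trunc r) \<Longrightarrow> w \<notin> nodes r t \<Longrightarrow> t w = 0"
proof -
  assume "t \<in> range (trunc r)" "w \<notin> nodes r t"
  moreover from this(1) obtain \<xi> where t: "t = trunc r \<xi>" by auto
  ultimately have "w \<notin> nodes r \<xi>" by simp
  then show "t w = 0" by (simp add: t trunc_def)
qed

text \<open>The two sides are indexed by \<open>bool\<close>, with \<open>False\<close> for the left side; \<open>side b w\<close> is the side on which
  node \<open>w\<close> lies if the root lies on side \<open>b\<close>.\<close>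

definition side :: "bool \<Rightarrow> nat list \<Rightarrow> bool" where
  "side b w = (b \<noteq> odd (length w))"

lemma side_simps [simp]: "side b [] = b" "side b (w @ [i]) = (\<not> side b w)"
  by (auto simp: side_def)

text \<open>The half-edge of a vertex leading to its \<open>i\<close>-th child, when half-edge \<open>j\<close> leads to the parent.\<close>

definition skip :: "nat \<Rightarrow> nat \<Rightarrow> nat" where
  "skip j i = (if i < j then i else Suc i)"

lemma skip_neq [simp]: "skip j i \<noteq> j" "j \<noteq> skip j i"
  by (auto simp: skip_def)

lemma skip_inject [simp]: "skip j i = skip j i' \<longleftrightarrow> i = i'"
  by (auto simp: skip_def)

lemma skip_surj:
  assumes "j \<le> n" "j' \<le> n" "j' \<noteq> j" obtains i where "i < n" "skip j i = j'"
  by (rule that[of "if j' < j then j' else j' - 1"]) (use assms in \<open>auto simp: skip_def\<close>)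

text \<open>A placement \<open>x\<close> sends a node to a vertex together with the half-edge to its parent;
  \<open>half_at b x s w\<close> is the half-edge on side \<open>s\<close> of the edge between \<open>w\<close> and its parent.\<close>

definition half_at :: "bool \<Rightarrow> (nat list \<Rightarrow> 'v \<times> nat) \<Rightarrow> bool \<Rightarrow> nat list \<Rightarrow> 'v \<times> nat" where
  "half_at b x s w = (if side b w = s then x w
     else (fst (x (butlast w)), skip (snd (x (butlast w))) (last w)))"

locale bipartite_degrees =
  fixes V :: "bool \<Rightarrow> 'v set" and d :: "bool \<Rightarrow> 'v \<Rightarrow> nat"
  assumes finite_V [simp]: "finite (V b)"
    and V_disjoint: "V False \<inter> V True = {}"
    and sum_degrees: "(\<Sum>v\<in>V False. d False v) = (\<Sum>v\<in>V True. d True v)"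
begin

abbreviation halves :: "bool \<Rightarrow> ('v \<times> nat) set" where
  "halves b \<equiv> half_edges (V b) (d b)"

abbreviation all_matchings :: "('v \<times> nat \<Rightarrow> 'v \<times> nat) set" where
  "all_matchings \<equiv> matchings (V False) (d False) (V True) (d True)"

abbreviation graph :: "('v \<times> nat \<Rightarrow> 'v \<times> nat) \<Rightarrow> ('v, 'v \<times> nat) mgraph" where
  "graph \<omega> \<equiv> config_graph (V False) (d False) (V True) \<omega>"

lemma side_unique: "v \<in> V b \<Longrightarrow> v \<in> V b' \<Longrightarrow> b = b'"
  using V_disjoint by (cases b; cases b') auto

text \<open>The root has no parent; its second component is set to its degree, so that \<open>skip\<close> is the
  identity on its children.\<close>

definition slots :: "bool \<Rightarrow> (nat list \<Rightarrow> nat) \<Rightarrow> nat list \<Rightarrow> ('v \<times> nat) set" where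
  "slots b t w = {(v, j). v \<in> V (side b w) \<and>
     (if w = [] then d b v = t w \<and> j = t w else d (side b w) v = Suc (t w) \<and> j < Suc (t w))}"

definition embeddings :: "bool \<Rightarrow> nat \<Rightarrow> (nat list \<Rightarrow> nat) \<Rightarrow> (nat list \<Rightarrow> 'v \<times> nat) set" where
  "embeddings b r t = {x \<in> PiE (nodes r t) (slots b t). inj_on (\<lambda>w. fst (x w)) (nodes r t)}"

text \<open>Since \<open>slots\<close> prescribes the full degree of each vertex, the tree uses up
  every half-edge at a vertex of depth less than \<open>r\<close>. An occurrence is therefore the
  whole ball around its root vertex and not merely a subtree of it.\<close>

definition occurrences ::
  "bool \<Rightarrow> nat \<Rightarrow> (nat list \<Rightarrow> nat) \<Rightarrow> ('v \<times> nat \<Rightarrow> 'v \<times> nat) \<Rightarrow> (nat list \<Rightarrow> 'v \<times> nat) set" where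
  "occurrences b r t \<omega> = {x \<in> embeddings b r t.
     \<forall>w\<in>nodes r t - {[]}. \<omega> (half_at b x False w) = half_at b x True w}"

lemma slots_V: "y \<in> slots b t w \<Longrightarrow> fst y \<in> V (side b w)"
  by (auto simp: slots_def)

lemma slots_up: "y \<in> slots b t w \<Longrightarrow> w \<noteq> [] \<Longrightarrow> y \<in> halves (side b w)"
  by (auto simp: slots_def half_edges_def)

lemma slots_down:
  "y \<in> slots b t w \<Longrightarrow> i < t w \<Longrightarrow> (fst y, skip (snd y) i) \<in> halves (side b w)"
  by (auto simp: slots_def half_edges_def skip_def split: if_splits)

lemma slots_halves:
  assumes "y \<in> slots b t w" "(fst y, j) \<in> halves (side b w)"
  shows "snd y \<le> t w" "j \<le> t w" "w = [] \<Longrightarrow> j \<noteq> snd y"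
  using assms by (auto simp: slots_def half_edges_def split: if_splits)

lemma finite_slots [simp]: "finite (slots b t w)"
  by (rule finite_subset[of _ "V (side b w) \<times> {..t w}"]) (auto simp: slots_def split: if_splits)

lemma finite_embeddings [simp]: "finite (embeddings b r t)"
  unfolding embeddings_def by (rule finite_subset[of _ "PiE (nodes r t) (slots b t)"]) (auto intro: finite_PiE)

lemma finite_occurrences [simp]: "finite (occurrences b r t \<omega>)"
  by (simp add: occurrences_def)

lemma embeddingsD:
  assumes "x \<in> embeddings b r t"
  shows "\<And>w. w \<in> nodes r t \<Longrightarrow> x w \<in> slots b t w"
    and "inj_on (\<lambda>w. fst (x w)) (nodes r t)"
  using assms by (auto simp: embeddings_def)

lemma occurrencesD:
  assumes "x \<in> occurrences b r t \<omega>"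
  shows "x \<in> embeddings b r t"
    and "\<And>w. w \<in> nodes r t \<Longrightarrow> w \<noteq> [] \<Longrightarrow> \<omega> (half_at b x False w) = half_at b x True w"
  using assms by (auto simp: occurrences_def)

lemma half_at_halves:
  assumes "x \<in> embeddings b r t" "w \<in> nodes r t" "w \<noteq> []"
  shows "half_at b x s w \<in> halves s"
proof -
  from assms(2,3) obtain p i where w: "w = p @ [i]" "p \<in> nodes r t" "i < t p"
    by (auto elim: nodes_cases)
  show ?thesis
    using slots_up[OF embeddingsD(1)[OF assms(1,2)] assms(3)]
      slots_down[OF embeddingsD(1)[OF assms(1) w(2)] w(3)]
    by (auto simp: half_at_def w(1))
qed

text \<open>Two parent half-edges sit at different vertices; two child half-edges at one vertex are
  separated by injectivity of \<open>skip\<close>; and a child half-edge never equals the parent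
  half-edge of the same vertex, because \<open>skip j\<close> avoids \<open>j\<close>.\<close>

lemma half_at_inj:
  assumes "x \<in> embeddings b r t"
  shows "inj_on (half_at b x s) (nodes r t - {[]})"
proof (rule inj_onI)
  fix w w' assume w: "w \<in> nodes r t - {[]}" "w' \<in> nodes r t - {[]}"
    and eq: "half_at b x s w = half_at b x s w'"
  obtain p i p' i' where p: "w = p @ [i]" "p \<in> nodes r t" "w' = p' @ [i']" "p' \<in> nodes r t"
    using w by (auto elim!: nodes_cases[of w] nodes_cases[of w'])
  have inj: "fst (x u) = fst (x u') \<Longrightarrow> u = u'" if "u \<in> nodes r t" "u' \<in> nodes r t" for u u'
    using embeddingsD(2)[OF assms] that by (auto simp: inj_on_def)
  show "w = w'"
  proof (cases "side b w = s"; cases "side b w' = s")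
    assume "side b w = s" "side b w' = s"
    then show ?thesis using eq inj[of w w'] w by (auto simp: half_at_def)
  next
    assume "side b w \<noteq> s" "side b w' \<noteq> s"
    then show ?thesis using eq inj[of p p'] p by (auto simp: half_at_def)
  next
    assume s: "side b w = s" "side b w' \<noteq> s"
    then have "x w = (fst (x p'), skip (snd (x p')) i')" using eq p by (simp add: half_at_def)
    moreover from this have "w = p'" using inj[of w p'] w p by auto
    ultimately show ?thesis by (metis skip_neq(1) snd_conv)
  next
    assume s: "side b w \<noteq> s" "side b w' = s"
    then have "x w' = (fst (x p), skip (snd (x p)) i)" using eq p by (simp add: half_at_def)
    moreover from this have "w' = p" using inj[of w' p] w p by auto
    ultimately show ?thesis by (metis skip_neq(1) snd_conv)
  qed
qed

lemma fst_half_at: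
  assumes "w \<in> nodes r t"
  shows "fst (half_at b x s w) \<in> (\<lambda>w. fst (x w)) ` nodes r t"
  using assms by (cases rule: nodes_cases) (use assms in \<open>auto simp: half_at_def\<close>)

lemma matchingD:
  assumes "\<omega> \<in> all_matchings"
  shows "inj_on \<omega> (halves False)" "\<And>h. h \<in> halves False \<Longrightarrow> \<omega> h \<in> halves True"
  using assms by (auto simp: matchings_def bij_betw_def)

text \<open>Exhaustion: at the vertex of \<open>p\<close> the parent half-edge and the
  \<open>t p\<close> child half-edges are all there are, by surjectivity of \<open>skip\<close>. If
  this vertex is on the right, the comparison is between values of \<omega>, and injectivity of
  \<omega> brings it back to the left half-edge that names the edge.\<close>

lemma occurrence_half_edge:
  assumes \<omega>: "\<omega> \<in> all_matchings" and x: "x \<in> occurrences b r t \<omega>" and h: "h \<in> halves False"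
    and p: "p \<in> nodes r t" "length p < r" and eq: "fst (if side b p then \<omega> h else h) = fst (x p)"
  obtains w where "w \<in> nodes r t" "w \<noteq> []" "h = half_at b x False w" "w = p \<or> (\<exists>i. w = p @ [i])"
proof -
  let ?s = "side b p" and ?g = "if side b p then \<omega> h else h"
  have g: "?g \<in> halves ?s" using matchingD[OF \<omega>] h by simp
  have xp: "x p \<in> slots b t p" using embeddingsD(1)[OF occurrencesD(1)[OF x] p(1)] .
  obtain j where j: "?g = (fst (x p), j)" using eq by (metis prod.collapse)
  note sl = slots_halves[OF xp, of j, folded j, OF g]
  obtain w where w: "w \<in> nodes r t" "w \<noteq> []" "?g = half_at b x ?s w" "w = p \<or> (\<exists>i. w = p @ [i])"
  proof (cases "j = snd (x p)")
    case True
    \<comment> \<open>For the root, \<open>snd (x p)\<close> is its degree and not the index of a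
      half-edge. So \<open>p\<close> is not the root here, and the half-edge leads to its
      parent.\<close>
    then show ?thesis using sl(3) j p(1) by (intro that[of p]) (auto simp: half_at_def)
  next
    case False
    then obtain i where i: "i < t p" "skip (snd (x p)) i = j"
      using skip_surj[OF sl(1,2)] by blast
    show ?thesis
      by (rule that[of "p @ [i]"]) (use i j p in \<open>auto simp: half_at_def snoc_in_nodes\<close>)
  qed
  have "h = half_at b x False w"
  proof (cases ?s)
    case True
    then have "\<omega> h = \<omega> (half_at b x False w)"
      using w occurrencesD(2)[OF x w(1,2)] by simp
    then show ?thesis
      using matchingD(1)[OF \<omega>] h half_at_halves[OF occurrencesD(1)[OF x] w(1,2)]
      by (auto dest: inj_onD)
  qed (use w in simp)
  with w show ?thesis by (intro that)
qed

lemma ends_half_at: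
  "Upair (fst (half_at b x False w)) (fst (half_at b x True w)) = Upair (fst (x (butlast w))) (fst (x w))"
  by (auto simp: half_at_def)

text \<open>The vertex map \<phi> forgets the half-edge to the parent. The edge map \<psi>
  translates between the two naming conventions: a tree edge is named after its child, a graph edge
  after its left half-edge.\<close>

lemma tree_ball_occurrence:
  assumes \<omega>: "\<omega> \<in> all_matchings" and x: "x \<in> occurrences b r t \<omega>"
  shows "tree_ball r t \<simeq> rooted_ball r (graph \<omega>, fst (x []))"
proof -
  define \<phi> where "\<phi> w = fst (x w)" for w
  define \<psi> where "\<psi> = half_at b x False"
  let ?N = "nodes r t" and ?G = "graph \<omega>"
  note emb = occurrencesD(1)[OF x]
  have inj: "inj_on \<phi> ?N" using embeddingsD(2)[OF emb] by (simp add: \<phi>_def[abs_def])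
  have \<phi>V: "\<phi> w \<in> V (side b w)" if "w \<in> ?N" for w
    using slots_V[OF embeddingsD(1)[OF emb that]] by (simp add: \<phi>_def)
  have \<psi>: "\<psi> w \<in> halves False" "Upair (fst (\<psi> w)) (fst (\<omega> (\<psi> w))) = Upair (\<phi> (butlast w)) (\<phi> w)"
    if "w \<in> ?N" "w \<noteq> []" for w
    using half_at_halves[OF emb that] occurrencesD(2)[OF x that] ends_half_at[of b x w]
    by (auto simp: \<psi>_def \<phi>_def)
  have edge: "\<exists>w\<in>?N. w \<noteq> [] \<and> h = \<psi> w \<and> (w = p \<or> (\<exists>i. w = p @ [i]))"
    if h: "h \<in> halves False" and p: "p \<in> ?N" "length p < r" and e: "\<phi> p \<in> {fst h, fst (\<omega> h)}" for h p
  proof -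
    have "fst h \<in> V False" "fst (\<omega> h) \<in> V True"
      using h matchingD(2)[OF \<omega> h] by (auto simp: half_edges_def)
    then have "fst (if side b p then \<omega> h else h) = fst (x p)"
      using e \<phi>V[OF p(1)] V_disjoint by (cases "side b p") (auto simp: \<phi>_def)
    from occurrence_half_edge[OF \<omega> x h p this] show ?thesis
      unfolding \<psi>_def by metis
  qed
  have adj: "(y, z) \<in> adj ?G \<longleftrightarrow> (\<exists>h\<in>halves False. Upair (fst h) (fst (\<omega> h)) = Upair y z)" for y z
    by (simp add: adj_def config_graph_def)
  have ball: "{y. gdist ?G (\<phi> []) y \<le> enat r} = \<phi> ` ?N"
  proof (rule gdist_ball_eq)
    have "nodes 0 t = {[]}" by (auto simp: nodes_def)
    then show "\<phi> ` nodes 0 t = {\<phi> []}" by simp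
    fix k assume k: "k < r"
    then have sub: "nodes k t \<subseteq> ?N" "nodes (Suc k) t \<subseteq> ?N" using nodes_mono by simp_all
    show "\<phi> ` nodes (Suc k) t = \<phi> ` nodes k t \<union> adj ?G `` (\<phi> ` nodes k t)"
    proof (intro equalityI subsetI)
      fix y assume "y \<in> \<phi> ` nodes (Suc k) t"
      then obtain w where w: "w \<in> nodes (Suc k) t" "y = \<phi> w" by auto
      from w(1) show "y \<in> \<phi> ` nodes k t \<union> adj ?G `` (\<phi> ` nodes k t)"
      proof (cases rule: nodes_cases)
        case (2 p i)
        then have p: "p \<in> nodes k t" by (auto simp: nodes_def)
        have "(\<phi> p, \<phi> w) \<in> adj ?G"
          unfolding adj using \<psi>[of w] 2(1) w(1) sub by (intro bexI[of _ "\<psi> w"]) auto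
        then show ?thesis using p w(2) by blast
      qed (use w in auto)
    next
      fix y assume "y \<in> \<phi> ` nodes k t \<union> adj ?G `` (\<phi> ` nodes k t)"
      then consider "y \<in> \<phi> ` nodes k t" | p where "p \<in> nodes k t" "(\<phi> p, y) \<in> adj ?G" by auto
      then show "y \<in> \<phi> ` nodes (Suc k) t"
      proof cases
        case 1
        then show ?thesis using nodes_mono[of k "Suc k" t] by auto
      next
        case 2
        then obtain h where h: "h \<in> halves False" "Upair (fst h) (fst (\<omega> h)) = Upair (\<phi> p) y"
          unfolding adj by auto
        have p: "p \<in> ?N" "length p < r" using 2(1) sub k by (auto simp: nodes_def)
        have "\<phi> p \<in> {fst h, fst (\<omega> h)}" using h(2) by auto
        from edge[OF h(1) p this] obtain w where
          w: "w \<in> ?N" "w \<noteq> []" "h = \<psi> w" "w = p \<or> (\<exists>i. w = p @ [i])" by blast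
        have bw: "butlast w \<in> nodes k t" "w \<in> nodes (Suc k) t"
          using w 2(1) k butlast_in_nodes[OF 2(1)] nodes_mono[of k "Suc k" t]
          by (auto simp: snoc_in_nodes) (auto simp: nodes_def)
        have "Upair (\<phi> (butlast w)) (\<phi> w) = Upair (\<phi> p) y"
          using h(2) \<psi>(2)[OF w(1,2)] w(3) by simp
        then have "y = \<phi> w \<or> y = \<phi> (butlast w)" by auto
        then show ?thesis using bw nodes_mono[of k "Suc k" t] by auto
      qed
    qed
  qed
  have \<phi>N: "\<phi> ` ?N \<subseteq> verts ?G"
  proof -
    have "V s \<subseteq> verts ?G" for s by (cases s) (auto simp: config_graph_def)
    then show ?thesis using \<phi>V by blast
  qed
  have bij\<phi>: "bij_betw \<phi> ?N (verts ?G \<inter> {y \<in> verts ?G. gdist ?G (\<phi> []) y \<le> enat r})"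
    using inj ball \<phi>N by (auto simp: bij_betw_def)
  have ball': "{y \<in> verts ?G. gdist ?G (\<phi> []) y \<le> enat r} = \<phi> ` ?N"
    using ball \<phi>N by auto
  have "\<psi> ` (?N - {[]}) = {h \<in> halves False. {fst h, fst (\<omega> h)} \<subseteq> \<phi> ` ?N}"
  proof (intro equalityI subsetI)
    fix h assume "h \<in> \<psi> ` (?N - {[]})"
    then obtain w where w: "w \<in> ?N" "w \<noteq> []" "h = \<psi> w" by auto
    have "butlast w \<in> ?N" using w(1) by (rule butlast_in_nodes)
    then show "h \<in> {h \<in> halves False. {fst h, fst (\<omega> h)} \<subseteq> \<phi> ` ?N}"
      using \<psi>[OF w(1,2)] w by auto
  next
    fix h assume "h \<in> {h \<in> halves False. {fst h, fst (\<omega> h)} \<subseteq> \<phi> ` ?N}"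
    then obtain w w' where w: "h \<in> halves False" "w \<in> ?N" "w' \<in> ?N" "fst h = \<phi> w" "fst (\<omega> h) = \<phi> w'"
      by auto
    have "fst h \<in> V False" "fst (\<omega> h) \<in> V True"
      using w(1) matchingD(2)[OF \<omega> w(1)] by (auto simp: half_edges_def)
    then have "side b w = False" "side b w' = True"
      using w(4,5) \<phi>V[OF w(2)] \<phi>V[OF w(3)] side_unique by metis+
    \<comment> \<open>Bipartiteness excludes further edges between vertices at distance exactly
      \<open>r\<close>: the ends of an edge have depths of different parity, so one of them has
      depth less than \<open>r\<close> and all its half-edges belong to the tree.\<close>
    then have "length w \<noteq> length w'" by (auto simp: side_def)
    then have "length w < r \<or> length w' < r" using w(2,3) by (auto simp: nodes_def)
    then have "\<exists>w\<in>?N. w \<noteq> [] \<and> h = \<psi> w"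
      using edge[OF w(1,2)] edge[OF w(1,3)] w(4,5) by (metis insertCI)
    then show "h \<in> \<psi> ` (?N - {[]})" by auto
  qed
  then have bij\<psi>: "bij_betw \<psi> (?N - {[]}) {h \<in> halves False. {fst h, fst (\<omega> h)} \<subseteq> \<phi> ` ?N}"
    using half_at_inj[OF emb] by (simp add: bij_betw_def \<psi>_def)
  show ?thesis
    unfolding tree_ball_def rooted_ball_def rooted_iso_def induced_subgraph_def prod.case
    using bij\<phi> bij\<psi> \<psi>(2) ball'
    by (intro exI[of _ \<phi>] exI[of _ \<psi>]) (simp add: config_graph_def \<phi>_def[of "[]"])
qed

text \<open>If the child lies on the right, \<omega> is applied to the common left half-edge; if it
  lies on the left, injectivity of \<omega> recovers it from the common right half-edge.\<close>

lemma occurrences_step: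
  assumes \<omega>: "\<omega> \<in> all_matchings" and x: "x \<in> occurrences b r t \<omega>" "x' \<in> occurrences b r t' \<omega>"
    and w: "w @ [i] \<in> nodes r t" "w @ [i] \<in> nodes r t'" and eq: "x w = x' w"
  shows "x (w @ [i]) = x' (w @ [i])"
proof -
  have "\<omega> (half_at b x False (w @ [i])) = half_at b x True (w @ [i])"
    "\<omega> (half_at b x' False (w @ [i])) = half_at b x' True (w @ [i])"
    using occurrencesD(2)[OF x(1)] occurrencesD(2)[OF x(2)] w by auto
  moreover have "half_at b x False (w @ [i]) \<in> halves False" "half_at b x' False (w @ [i]) \<in> halves False"
    using half_at_halves[OF occurrencesD(1)[OF x(1)]] half_at_halves[OF occurrencesD(1)[OF x(2)]] w by auto
  ultimately show ?thesis
    using eq matchingD(1)[OF \<omega>] by (auto simp: half_at_def inj_on_def split: if_splits)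
qed

lemma slots_eqD:
  assumes "y \<in> slots b t w" "y' \<in> slots b t' w" "fst y = fst y'"
  shows "t w = t' w" "w = [] \<Longrightarrow> y = y'"
  using assms by (auto simp: slots_def split: if_splits)

text \<open>Exploration from a given vertex is deterministic: the position of a node determines that
  of each child, and the degree of the vertex reached determines the offspring number there.\<close>

lemma occurrences_agree:
  assumes \<omega>: "\<omega> \<in> all_matchings" and x: "x \<in> occurrences b r t \<omega>" "x' \<in> occurrences b r t' \<omega>"
    and root: "fst (x []) = fst (x' [])" and "w \<in> nodes r t"
  shows "w \<in> nodes r t' \<and> t w = t' w \<and> x w = x' w"
  using assms(5)
proof (induction rule: nodes_induct)
  case Nil
  show ?case
    using slots_eqD[of "x []" b t "[]" "x' []" t'] root
      embeddingsD(1)[OF occurrencesD(1)[OF x(1)]] embeddingsD(1)[OF occurrencesD(1)[OF x(2)]]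
    by auto
next
  case (snoc w i)
  then have w: "w @ [i] \<in> nodes r t" "w @ [i] \<in> nodes r t'" by (auto simp: snoc_in_nodes)
  then have eq: "x (w @ [i]) = x' (w @ [i])" using occurrences_step[OF \<omega> x] snoc by blast
  moreover have "t (w @ [i]) = t' (w @ [i])"
    using slots_eqD(1)[OF embeddingsD(1)[OF occurrencesD(1)[OF x(1)] w(1)]
        embeddingsD(1)[OF occurrencesD(1)[OF x(2)] w(2)]] eq by simp
  ultimately show ?case using w by blast
qed

text \<open>Truncated trees vanish outside their nodes, so agreement on the nodes is equality. A
  vertex is thus the root of at most one occurrence, over all trees of the given depth.\<close>

lemma occurrences_unique:
  assumes \<omega>: "\<omega> \<in> all_matchings" and x: "x \<in> occurrences b r t \<omega>" "x' \<in> occurrences b r t' \<omega>"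
    and root: "fst (x []) = fst (x' [])" and t: "t \<in> range (trunc r)" "t' \<in> range (trunc r)"
  shows "t = t'" "x = x'"
proof -
  note a = occurrences_agree[OF \<omega> x root] occurrences_agree[OF \<omega> x(2,1) root[symmetric]]
  have N: "nodes r t = nodes r t'" using a by blast
  show "t = t'"
  proof
    fix w show "t w = t' w"
      using a(1) trunc_eq_0[OF t(1)] trunc_eq_0[OF t(2)] N by (cases "w \<in> nodes r t") auto
  qed
  show "x = x'"
  proof (rule extensionalityI)
    show "x \<in> extensional (nodes r t)" "x' \<in> extensional (nodes r t)"
      using x N by (auto simp: occurrences_def embeddings_def PiE_def)
  qed (use a(1) in blast)
qed

end

section \<open>Moments of the number of occurrences\<close>

context bipartite_degrees begin

definition overlap :: "nat \<Rightarrow> (nat list \<Rightarrow> nat) \<Rightarrow> (nat list \<Rightarrow> 'v \<times> nat) \<Rightarrow> (nat list \<Rightarrow> 'v \<times> nat) \<Rightarrow> bool" where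
  "overlap r t x x' \<longleftrightarrow> (\<lambda>w. fst (x w)) ` nodes r t \<inter> (\<lambda>w. fst (x' w)) ` nodes r t \<noteq> {}"

text \<open>Walking up from \<open>v\<close> to the root of the occurrence, each step is determined by one of at most
  \<open>K\<close> half-edges.\<close>

lemma card_occurrences_through:
  assumes \<omega>: "\<omega> \<in> all_matchings" and t: "t \<in> range (trunc r)"
    and K: "\<And>w. w \<in> nodes r t \<Longrightarrow> t w < K" and w: "w \<in> nodes r t"
  shows "card {x \<in> occurrences b r t \<omega>. fst (x w) = v} \<le> K ^ length w"
  using w
proof (induction arbitrary: v rule: nodes_induct)
  case Nil
  have "card {x \<in> occurrences b r t \<omega>. fst (x []) = v} \<le> Suc 0"
    by (subst card_le_Suc0_iff_eq) (auto intro: occurrences_unique(2)[OF \<omega> _ _ _ t t])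
  then show ?case by simp
next
  case (snoc p i)
  let ?O = "occurrences b r t \<omega>" and ?w = "p @ [i]"
  \<comment> \<open>The vertex at the other end of half-edge \<open>j\<close> of \<open>v\<close>;
    for \<open>v\<close> on the right it is found through the inverse matching. Where
    \<open>(v, j)\<close> is no half-edge the value is arbitrary, which is harmless for an upper
    bound.\<close>
  define u where "u j = fst (if side b ?w then inv_into (halves False) \<omega> (v, j) else \<omega> (v, j))" for j
  have w: "?w \<in> nodes r t" using snoc by (auto simp: snoc_in_nodes)
  have "{x \<in> ?O. fst (x ?w) = v} \<subseteq> (\<Union>j<K. {x \<in> ?O. fst (x p) = u j})"
  proof
    fix x assume "x \<in> {x \<in> ?O. fst (x ?w) = v}"
    then have x: "x \<in> ?O" "fst (x ?w) = v" by auto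
    define j where "j = snd (x ?w)"
    have xw: "x ?w = (v, j)" using x by (simp add: j_def prod_eq_iff)
    have "j < K"
      using embeddingsD(1)[OF occurrencesD(1)[OF x(1)] w] K[OF w] xw
      by (auto simp: slots_def)
    moreover have "fst (x p) = u j"
    proof (cases "side b ?w")
      case True
      have "\<omega> (half_at b x False ?w) = (v, j)"
        using occurrencesD(2)[OF x(1) w] True xw by (auto simp: half_at_def)
      then have "inv_into (halves False) \<omega> (v, j) = half_at b x False ?w"
        using matchingD(1)[OF \<omega>] half_at_halves[OF occurrencesD(1)[OF x(1)] w]
        by (metis append_is_Nil_conv inv_into_f_f list.distinct(1))
      then show ?thesis using True by (simp add: u_def half_at_def)
    next
      case False
      then show ?thesis
        using occurrencesD(2)[OF x(1) w] xw by (simp add: u_def half_at_def)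
    qed
    ultimately show "x \<in> (\<Union>j<K. {x \<in> ?O. fst (x p) = u j})" using x(1) by blast
  qed
  then have "card {x \<in> ?O. fst (x ?w) = v} \<le> card (\<Union>j<K. {x \<in> ?O. fst (x p) = u j})"
    by (intro card_mono) auto
  also have "\<dots> \<le> (\<Sum>j<K. card {x \<in> ?O. fst (x p) = u j})"
    by (rule card_UN_le) simp
  also have "\<dots> \<le> (\<Sum>j<K. K ^ length p)"
    by (intro sum_mono snoc.IH)
  finally show ?case by simp
qed

lemma card_occurrences_le:
  assumes \<omega>: "\<omega> \<in> all_matchings" and t: "t \<in> range (trunc r)"
  shows "card (occurrences b r t \<omega>) \<le> card (V b)"
proof (rule card_inj_on_le)
  show "inj_on (\<lambda>x. fst (x [])) (occurrences b r t \<omega>)"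
    by (auto intro!: inj_onI occurrences_unique(2)[OF \<omega> _ _ _ t t])
  show "(\<lambda>x. fst (x [])) ` occurrences b r t \<omega> \<subseteq> V b"
    using slots_V[OF embeddingsD(1)[OF occurrencesD(1)], of _ b r t \<omega> "[]"] by auto
qed simp

text \<open>The first occurrence is given by its root. The second then shares a vertex with it,
  which costs a choice of two nodes and the bound for occurrences through a given vertex. The total
  is linear in \<open>card (V b)\<close>, hence negligible against its square.\<close>

lemma card_overlapping_occurrences:
  assumes \<omega>: "\<omega> \<in> all_matchings" and t: "t \<in> range (trunc r)"
    and K: "\<And>w. w \<in> nodes r t \<Longrightarrow> t w < K"
  shows "card {(x, x') \<in> occurrences b r t \<omega> \<times> occurrences b r t \<omega>. overlap r t x x'}
    \<le> card (V b) * ((card (nodes r t))\<^sup>2 * K ^ r)"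
proof -
  let ?O = "occurrences b r t \<omega>" and ?N = "nodes r t"
  have K1: "1 \<le> K" using K[of "[]"] by simp
  have "card {x' \<in> ?O. overlap r t x x'} \<le> (card ?N)\<^sup>2 * K ^ r" for x
  proof -
    have "card {x' \<in> ?O. overlap r t x x'}
        \<le> card (\<Union>(w, w')\<in>?N \<times> ?N. {x' \<in> ?O. fst (x' w') = fst (x w)})"
    proof (intro card_mono)
      show "finite (\<Union>(w, w')\<in>?N \<times> ?N. {x' \<in> ?O. fst (x' w') = fst (x w)})" by auto
    qed (fastforce simp: overlap_def)
    also have "\<dots> \<le> (\<Sum>(w, w')\<in>?N \<times> ?N. card {x' \<in> ?O. fst (x' w') = fst (x w)})"
      unfolding case_prod_beta by (rule card_UN_le) simp
    also have "\<dots> \<le> (\<Sum>(w, w')\<in>?N \<times> ?N. K ^ r)"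
    proof (intro sum_mono, clarify)
      fix w w' assume "w' \<in> ?N"
      then have "card {x' \<in> ?O. fst (x' w') = fst (x w)} \<le> K ^ length w'"
        by (intro card_occurrences_through[OF \<omega> t K])
      also have "\<dots> \<le> K ^ r"
        using \<open>w' \<in> ?N\<close> K1 by (intro power_increasing) (auto simp: nodes_def)
      finally show "card {x' \<in> ?O. fst (x' w') = fst (x w)} \<le> K ^ r" .
    qed
    finally show ?thesis by (simp add: power2_eq_square)
  qed
  then have "(\<Sum>x\<in>?O. card {x' \<in> ?O. overlap r t x x'}) \<le> (\<Sum>x\<in>?O. (card ?N)\<^sup>2 * K ^ r)"
    by (intro sum_mono)
  also have "\<dots> \<le> card (V b) * ((card ?N)\<^sup>2 * K ^ r)"
    using card_occurrences_le[OF \<omega> t] by simp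
  also have "(\<Sum>x\<in>?O. card {x' \<in> ?O. overlap r t x x'}) = card (SIGMA x:?O. {x' \<in> ?O. overlap r t x x'})"
    by (rule card_SigmaI[symmetric]) auto
  also have "(SIGMA x:?O. {x' \<in> ?O. overlap r t x x'}) = {(x, x') \<in> ?O \<times> ?O. overlap r t x x'}"
    by auto
  finally show ?thesis .
qed

definition half_edge_count :: nat where
  "half_edge_count = (\<Sum>v\<in>V False. d False v)"

definition pairs :: "bool \<Rightarrow> nat \<Rightarrow> (nat list \<Rightarrow> nat) \<Rightarrow> (nat list \<Rightarrow> 'v \<times> nat) \<Rightarrow> (('v \<times> nat) \<times> ('v \<times> nat)) set" where
  "pairs b r t x = (\<lambda>w. (half_at b x False w, half_at b x True w)) ` (nodes r t - {[]})"

lemma finite_all_matchings [simp]: "finite all_matchings"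
  by (simp add: finite_matchings)

lemma card_all_matchings: "card all_matchings = fact half_edge_count"
  using card_matchings_extending[of "V False" "V True" "d False" "d True" "{}"] sum_degrees
  by (simp add: half_edge_count_def)

lemma occurrences_iff:
  "x \<in> occurrences b r t \<omega> \<longleftrightarrow> x \<in> embeddings b r t \<and> (\<forall>(a, c)\<in>pairs b r t x. \<omega> a = c)"
  by (auto simp: occurrences_def pairs_def)

lemma pairs_embedding:
  assumes "x \<in> embeddings b r t"
  shows "pairs b r t x \<subseteq> halves False \<times> halves True"
    and "inj_on fst (pairs b r t x)" "inj_on snd (pairs b r t x)"
    and "card (pairs b r t x) = card (nodes r t) - 1"
    and "\<And>a c. (a, c) \<in> pairs b r t x \<Longrightarrow> fst a \<in> (\<lambda>w. fst (x w)) ` nodes r t \<and> fst c \<in> (\<lambda>w. fst (x w)) ` nodes r t"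
proof -
  let ?N = "nodes r t - {[]}"
  show "pairs b r t x \<subseteq> halves False \<times> halves True"
    using half_at_halves[OF assms] by (auto simp: pairs_def)
  show "inj_on fst (pairs b r t x)" "inj_on snd (pairs b r t x)"
    unfolding pairs_def using half_at_inj[OF assms]
    by (auto intro!: inj_on_imageI simp: comp_def)
  have "inj_on (\<lambda>w. (half_at b x False w, half_at b x True w)) ?N"
    using half_at_inj[OF assms, of False] by (intro inj_onI) (auto dest: inj_onD)
  then show "card (pairs b r t x) = card (nodes r t) - 1"
    by (simp add: pairs_def card_image)
  show "fst a \<in> (\<lambda>w. fst (x w)) ` nodes r t \<and> fst c \<in> (\<lambda>w. fst (x w)) ` nodes r t"
    if "(a, c) \<in> pairs b r t x" for a c
    using that fst_half_at[of _ r t b x] unfolding pairs_def by (auto simp del: image_iff)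
qed

text \<open>Double counting: each placement is realised by exactly the matchings that extend its
  prescribed pairs, one pair for each node other than the root.\<close>

lemma sum_card_occurrences:
  "(\<Sum>\<omega>\<in>all_matchings. card (occurrences b r t \<omega>)) =
    card (embeddings b r t) * fact (half_edge_count - (card (nodes r t) - 1))"
proof -
  let ?E = "embeddings b r t"
  have "(\<Sum>\<omega>\<in>all_matchings. card (occurrences b r t \<omega>)) =
      (\<Sum>\<omega>\<in>all_matchings. \<Sum>x | x \<in> ?E \<and> (\<forall>(a, c)\<in>pairs b r t x. \<omega> a = c). 1)"
    by (simp add: occurrences_iff[abs_def] flip: Collect_conj_eq) (simp add: Collect_mem_eq flip: occurrences_iff)
  also have "\<dots> = (\<Sum>x\<in>?E. \<Sum>\<omega> | \<omega> \<in> all_matchings \<and> (\<forall>(a, c)\<in>pairs b r t x. \<omega> a = c). 1)"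
    by (rule sum.swap_restrict) auto
  also have "\<dots> = (\<Sum>x\<in>?E. fact (half_edge_count - (card (nodes r t) - 1)))"
  proof (rule sum.cong[OF refl])
    fix x assume "x \<in> ?E"
    note p = pairs_embedding[OF this]
    show "(\<Sum>\<omega> | \<omega> \<in> all_matchings \<and> (\<forall>(a, c)\<in>pairs b r t x. \<omega> a = c). 1) =
        fact (half_edge_count - (card (nodes r t) - 1))"
      using card_matchings_extending[OF finite_V finite_V sum_degrees p(1-3)] p(4)
      by (simp add: half_edge_count_def)
  qed
  finally show ?thesis by simp
qed

text \<open>The square counts ordered pairs of occurrences. Overlapping pairs are bounded for each
  matching separately. Vertex-disjoint placements have disjoint half-edges, so together they
  prescribe a partial matching with twice as many pairs.\<close>

lemma sum_card_occurrences_sq: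
  assumes t: "t \<in> range (trunc r)" and K: "\<And>w. w \<in> nodes r t \<Longrightarrow> t w < K"
  shows "(\<Sum>\<omega>\<in>all_matchings. (card (occurrences b r t \<omega>))\<^sup>2) \<le>
    (card (embeddings b r t))\<^sup>2 * fact (half_edge_count - 2 * (card (nodes r t) - 1)) +
    fact half_edge_count * (card (V b) * ((card (nodes r t))\<^sup>2 * K ^ r))"
proof -
  let ?E = "embeddings b r t" and ?m = "card (nodes r t) - 1"
  let ?O = "\<lambda>\<omega>. occurrences b r t \<omega>"
  define D where "D = {(x, x') \<in> ?E \<times> ?E. \<not> overlap r t x x'}"
  have fD: "finite D" by (rule finite_subset[of _ "?E \<times> ?E"]) (auto simp: D_def)
  let ?R = "\<lambda>\<omega> (x, x'). \<forall>(a, c)\<in>pairs b r t x \<union> pairs b r t x'. \<omega> a = c"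
  have split: "(card (?O \<omega>))\<^sup>2 \<le> card {p \<in> D. ?R \<omega> p} + card (V b) * ((card (nodes r t))\<^sup>2 * K ^ r)"
    if \<omega>: "\<omega> \<in> all_matchings" for \<omega>
  proof -
    have "(card (?O \<omega>))\<^sup>2 = card (?O \<omega> \<times> ?O \<omega>)"
      by (simp add: card_cartesian_product power2_eq_square)
    also have "?O \<omega> \<times> ?O \<omega> = {p \<in> D. ?R \<omega> p} \<union> {(x, x') \<in> ?O \<omega> \<times> ?O \<omega>. overlap r t x x'}"
      by (auto simp: D_def occurrences_iff)
    also have "card \<dots> \<le> card {p \<in> D. ?R \<omega> p} + card {(x, x') \<in> ?O \<omega> \<times> ?O \<omega>. overlap r t x x'}"
      by (rule card_Un_le)
    also have "\<dots> \<le> card {p \<in> D. ?R \<omega> p} + card (V b) * ((card (nodes r t))\<^sup>2 * K ^ r)"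
      using card_overlapping_occurrences[OF \<omega> t K] by simp
    finally show ?thesis .
  qed
  have "(\<Sum>\<omega>\<in>all_matchings. (card (?O \<omega>))\<^sup>2) \<le>
      (\<Sum>\<omega>\<in>all_matchings. card {p \<in> D. ?R \<omega> p} + card (V b) * ((card (nodes r t))\<^sup>2 * K ^ r))"
    by (intro sum_mono split)
  also have "\<dots> = (\<Sum>\<omega>\<in>all_matchings. \<Sum>p | p \<in> D \<and> ?R \<omega> p. 1) +
      fact half_edge_count * (card (V b) * ((card (nodes r t))\<^sup>2 * K ^ r))"
    by (simp add: sum.distrib card_all_matchings)
  also have "(\<Sum>\<omega>\<in>all_matchings. \<Sum>p | p \<in> D \<and> ?R \<omega> p. 1) =
      (\<Sum>p\<in>D. \<Sum>\<omega> | \<omega> \<in> all_matchings \<and> ?R \<omega> p. 1)"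
    by (rule sum.swap_restrict) (auto simp: fD)
  also have "\<dots> = (\<Sum>p\<in>D. fact (half_edge_count - 2 * ?m))"
  proof (rule sum.cong[OF refl])
    fix p assume "p \<in> D"
    then obtain x x' where p: "p = (x, x')" "x \<in> ?E" "x' \<in> ?E" "\<not> overlap r t x x'"
      by (auto simp: D_def)
    note q = pairs_embedding[OF p(2)] and q' = pairs_embedding[OF p(3)]
    let ?P = "pairs b r t x" and ?P' = "pairs b r t x'"
    have sep: "a \<noteq> a'" "c \<noteq> c'" if "(a, c) \<in> ?P" "(a', c') \<in> ?P'" for a c a' c'
      using q(5)[OF that(1)] q'(5)[OF that(2)] p(4) by (auto simp: overlap_def)
    have "?P \<inter> ?P' = {}" using sep by fast
    then have card: "card (?P \<union> ?P') = 2 * ?m"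
      using q(4) q'(4) by (subst card_Un_disjoint) (auto simp: pairs_def)
    have inj: "inj_on fst (?P \<union> ?P')" "inj_on snd (?P \<union> ?P')"
      unfolding inj_on_Un using q(2,3) q'(2,3) sep by fastforce+
    show "(\<Sum>\<omega> | \<omega> \<in> all_matchings \<and> ?R \<omega> p. 1) = fact (half_edge_count - 2 * ?m)"
      using card_matchings_extending[OF finite_V finite_V sum_degrees _ inj] q(1) q'(1) card
      by (simp add: half_edge_count_def p(1))
  qed
  also have "\<dots> = card D * fact (half_edge_count - 2 * ?m)" by simp
  also have "card D \<le> (card ?E)\<^sup>2"
    using card_mono[of "?E \<times> ?E" D]
    by (auto simp: D_def card_cartesian_product power2_eq_square)
  finally show ?thesis by simp
qed

end

section \<open>Counting embeddings\<close>

lemma pmf_size_biased: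
  assumes int: "integrable (measure_pmf D) real" and pos: "pmf_mean D > 0"
  shows "pmf (size_biased D) k = real (k + 1) * pmf D (k + 1) / pmf_mean D"
  unfolding size_biased_def
proof (rule pmf_embed_pmf)
  let ?f = "\<lambda>k. ennreal (real k * pmf D k / pmf_mean D)"
  have "(\<integral>\<^sup>+ k. ennreal (real (k + 1) * pmf D (k + 1) / pmf_mean D) \<partial>count_space UNIV)
      = (\<integral>\<^sup>+ k. ?f (Suc k) \<partial>count_space UNIV)" by simp
  also have "\<dots> = (\<integral>\<^sup>+ k. ?f k \<partial>count_space {0<..})"
    by (rule nn_integral_bij_count_space) (auto simp: bij_betw_def image_Suc_lessThan greaterThan_0)
  \<comment> \<open>The point 0 may be added back because of the factor \<open>k\<close>; the total
    mass then becomes the mean divided by itself.\<close>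
  also have "\<dots> = (\<integral>\<^sup>+ k. ?f k * indicator {0<..} k \<partial>count_space UNIV)"
    by (rule nn_integral_count_space_indicator) simp
  also have "\<dots> = (\<integral>\<^sup>+ k. ennreal (pmf D k) * ennreal (real k / pmf_mean D) \<partial>count_space UNIV)"
    using pos by (intro nn_integral_cong) (auto simp: indicator_def simp flip: ennreal_mult' intro!: arg_cong[where f = ennreal])
  also have "\<dots> = (\<integral>\<^sup>+ k. ennreal (real k / pmf_mean D) \<partial>measure_pmf D)"
    by (rule nn_integral_measure_pmf[symmetric])
  also have "\<dots> = ennreal (measure_pmf.expectation D (\<lambda>k. real k / pmf_mean D))"
    using int pos by (intro nn_integral_eq_integral) auto
  also have "measure_pmf.expectation D (\<lambda>k. real k / pmf_mean D) = 1"
    using pos by simp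
  finally show "(\<integral>\<^sup>+ k. ennreal (real (k + 1) * pmf D (k + 1) / pmf_mean D) \<partial>count_space UNIV) = 1"
    by simp
qed (use pos in simp)

text \<open>Chebyshev's inequality centred at the limit \<open>c\<close>: the mean of
  \<open>(X - c)^2\<close> is at most \<open>B - 2 c A + c^2\<close>, where \<open>A\<close> is the
  mean of \<open>X\<close>, and this tends to 0.\<close>

lemma tendsto_in_prob_second_moment:
  assumes fin: "\<And>n. finite (set_pmf (p n))"
    and mean: "(\<lambda>n. measure_pmf.expectation (p n) (X n)) \<longlonglongrightarrow> c"
    and sq: "\<forall>\<^sub>F n in sequentially. measure_pmf.expectation (p n) (\<lambda>x. (X n x)\<^sup>2) \<le> B n"
    and B: "B \<longlonglongrightarrow> c\<^sup>2"
  shows "tendsto_in_prob p X c"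
  unfolding tendsto_in_prob_def
proof (intro allI impI)
  fix \<epsilon> :: real assume \<epsilon>: "\<epsilon> > 0"
  let ?A = "\<lambda>n. measure_pmf.expectation (p n) (X n)"
  note [simp] = integrable_measure_pmf_finite[OF fin]
  have bound: "measure_pmf.prob (p n) {x. \<bar>X n x - c\<bar> > \<epsilon>} \<le> (B n - 2 * c * ?A n + c\<^sup>2) / \<epsilon>\<^sup>2"
    if "measure_pmf.expectation (p n) (\<lambda>x. (X n x)\<^sup>2) \<le> B n" for n
  proof -
    have "measure_pmf.prob (p n) {x. \<bar>X n x - c\<bar> > \<epsilon>} =
        measure_pmf.expectation (p n) (indicator {x. \<bar>X n x - c\<bar> > \<epsilon>})" by simp
    also have "\<dots> \<le> measure_pmf.expectation (p n) (\<lambda>x. (X n x - c)\<^sup>2 / \<epsilon>\<^sup>2)"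
    proof (intro integral_mono)
      fix x
      have "\<epsilon>\<^sup>2 \<le> (X n x - c)\<^sup>2" if "\<bar>X n x - c\<bar> > \<epsilon>"
        using \<epsilon> that by (metis less_imp_le power2_abs power_mono)
      then show "indicator {x. \<bar>X n x - c\<bar> > \<epsilon>} x \<le> (X n x - c)\<^sup>2 / \<epsilon>\<^sup>2"
        using \<epsilon> by (auto simp: indicator_def)
    qed simp_all
    also have "\<dots> = measure_pmf.expectation (p n) (\<lambda>x. (X n x)\<^sup>2 - 2 * c * X n x + c\<^sup>2) / \<epsilon>\<^sup>2"
      by (simp add: power2_diff algebra_simps)
    also have "\<dots> = (measure_pmf.expectation (p n) (\<lambda>x. (X n x)\<^sup>2) - 2 * c * ?A n + c\<^sup>2) / \<epsilon>\<^sup>2"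
      by simp
    also have "\<dots> \<le> (B n - 2 * c * ?A n + c\<^sup>2) / \<epsilon>\<^sup>2"
      using that by (intro divide_right_mono) auto
    finally show ?thesis .
  qed
  have "(\<lambda>n. (B n - 2 * c * ?A n + c\<^sup>2) / \<epsilon>\<^sup>2) \<longlonglongrightarrow> (c\<^sup>2 - 2 * c * c + c\<^sup>2) / \<epsilon>\<^sup>2"
    using \<epsilon> by (intro tendsto_intros mean B) auto
  then have "(\<lambda>n. (B n - 2 * c * ?A n + c\<^sup>2) / \<epsilon>\<^sup>2) \<longlonglongrightarrow> 0"
    by (simp add: power2_eq_square)
  then show "(\<lambda>n. measure_pmf.prob (p n) {x. \<bar>X n x - c\<bar> > \<epsilon>}) \<longlonglongrightarrow> 0"
    by (rule tendsto_sandwich[OF _ _ tendsto_const, rotated 2])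
      (auto intro: eventually_mono[OF sq bound])
qed

text \<open>A product of \<open>m\<close> consecutive factors ending at \<open>h\<close> is
  asymptotic to \<open>h ^ m\<close>. So in the limit \<open>m\<close> prescribed pairs behave like
  independent events of probability \<open>1 / h\<close>.\<close>

lemma falling_factorial_asymp:
  "(\<lambda>h. real h ^ m * fact (h - m) / fact h) \<longlonglongrightarrow> 1"
proof (induction m)
  case (Suc m)
  have "(\<lambda>h. real h / (real h - real m)) \<longlonglongrightarrow> 1" by real_asymp
  from tendsto_mult[OF Suc this]
  have lim: "(\<lambda>h. real h ^ m * fact (h - m) / fact h * (real h / (real h - real m))) \<longlonglongrightarrow> 1" by simp
  have ev: "\<forall>\<^sub>F h in sequentially. real h ^ m * fact (h - m) / fact h * (real h / (real h - real m))
      = real h ^ Suc m * fact (h - Suc m) / fact h"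
    using eventually_gt_at_top[of m]
  proof eventually_elim
    case (elim h)
    then have "h - m = Suc (h - Suc m)" by simp
    then have "fact (h - m) = (real h - real m) * fact (h - Suc m)"
      using elim by (metis fact_Suc less_imp_le of_nat_diff)
    then show ?case using elim by simp
  qed
  show ?case using lim ev by (rule Lim_transform_eventually)
qed simp

section \<open>Placements and the loss through coinciding vertices\<close>

context bipartite_degrees begin

lemma card_halves: "card (halves b) = half_edge_count"
  using sum_degrees by (cases b) (simp_all add: half_edge_count_def card_half_edges)

lemma finite_halves [simp]: "finite (halves b)"
  by (simp add: half_edges_def)

lemma card_slots_Nil: "card (slots b t []) = card {v \<in> V b. d b v = t []}"
proof -
  have "slots b t [] = (\<lambda>v. (v, t [])) ` {v \<in> V b. d b v = t []}" by (auto simp: slots_def)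
  then show ?thesis by (simp add: card_image inj_on_def)
qed

text \<open>The factor \<open>Suc (t w)\<close> counts the choices of the half-edge to the parent;
  it becomes the size-biasing factor in the limit.\<close>

lemma card_slots:
  "w \<noteq> [] \<Longrightarrow> card (slots b t w) = Suc (t w) * card {v \<in> V (side b w). d (side b w) v = Suc (t w)}"
proof -
  assume "w \<noteq> []"
  then have "slots b t w = {v \<in> V (side b w). d (side b w) v = Suc (t w)} \<times> {..<Suc (t w)}"
    by (auto simp: slots_def)
  then show ?thesis by (simp add: card_cartesian_product)
qed

lemma card_slots_le: "w \<noteq> [] \<Longrightarrow> card (slots b t w) \<le> half_edge_count"
  using card_mono[OF finite_halves, of "slots b t w" "side b w"] slots_up[of _ b t w]
  by (force simp: card_halves)

lemma card_slots_Nil_le: "card (slots b t []) \<le> card (V b)"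
  unfolding card_slots_Nil by (intro card_mono) auto

text \<open>Given the rest of the placement, \<open>x w'\<close> is determined by its half-edge
  index, which is below \<open>K\<close>, because its vertex is that of \<open>w\<close>. One factor
  of at most \<open>half_edge_count\<close> is thus replaced by \<open>K\<close>. The node
  \<open>w'\<close> is not the root, so the factor \<open>card (V b)\<close> stays.\<close>

lemma card_candidates_coinciding:
  assumes K: "\<And>w. w \<in> nodes r t \<Longrightarrow> t w < K"
    and w: "w \<in> nodes r t" "w' \<in> nodes r t" "w \<noteq> w'" "w' \<noteq> []"
  shows "card {x \<in> PiE (nodes r t) (slots b t). fst (x w) = fst (x w')} * half_edge_count
    \<le> K * (card (V b) * half_edge_count ^ (card (nodes r t) - 1))"
proof -
  let ?N = "nodes r t"
  let ?S = "{x \<in> PiE ?N (slots b t). fst (x w) = fst (x w')}"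
  have "card ?S \<le> card (PiE (?N - {w'}) (slots b t) \<times> {..<K})"
  proof (rule card_inj_on_le)
    show "inj_on (\<lambda>x. (restrict x (?N - {w'}), snd (x w'))) ?S"
    proof (rule inj_onI)
      fix x y assume x: "x \<in> ?S" and y: "y \<in> ?S"
        and eq: "(restrict x (?N - {w'}), snd (x w')) = (restrict y (?N - {w'}), snd (y w'))"
      have *: "x u = y u" if "u \<in> ?N" "u \<noteq> w'" for u
        using eq that by (metis DiffI Pair_inject restrict_apply' singletonD)
      then have "x w' = y w'"
        using x y eq w *[of w] by (auto simp: prod_eq_iff)
      with * have "x u = y u" if "u \<in> ?N" for u using that by (cases "u = w'") auto
      then show "x = y" using x y by (intro PiE_ext[of x ?N "slots b t" y]) auto
    qed
    show "(\<lambda>x. (restrict x (?N - {w'}), snd (x w'))) ` ?S \<subseteq> PiE (?N - {w'}) (slots b t) \<times> {..<K}"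
    proof -
      have "snd (x w') < K" if "x \<in> PiE ?N (slots b t)" for x
        using PiE_mem[OF that w(2)] K[OF w(2)] by (auto simp: slots_def split: if_splits)
      moreover have "restrict x (?N - {w'}) \<in> PiE (?N - {w'}) (slots b t)" if "x \<in> PiE ?N (slots b t)" for x
        unfolding restrict_PiE_iff using PiE_mem[OF that] by blast
      ultimately show ?thesis by blast
    qed
  qed (simp add: finite_PiE)
  also have "\<dots> = K * (\<Prod>u\<in>?N - {w'}. card (slots b t u))"
    by (simp add: card_cartesian_product card_PiE)
  also have "\<dots> * half_edge_count \<le> K * (card (V b) * half_edge_count ^ (card ?N - 1))"
  proof -
    have eq: "?N - {w'} = insert [] (?N - {w', []})" using w(4) by auto
    have "(\<Prod>u\<in>?N - {w'}. card (slots b t u)) = card (slots b t []) * (\<Prod>u\<in>?N - {w', []}. card (slots b t u))"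
      unfolding eq by (subst prod.insert) auto
    also have "\<dots> \<le> card (V b) * (\<Prod>u\<in>?N - {w', []}. half_edge_count)"
      by (intro mult_mono card_slots_Nil_le prod_mono) (auto simp: card_slots_le)
    also have "\<dots> * half_edge_count = card (V b) * half_edge_count ^ (card ?N - 1)"
    proof -
      have "card (?N - {w', []}) = card ?N - 2"
        using w by (subst card_Diff_subset) auto
      moreover have "card ?N \<ge> 2"
        using card_mono[of ?N "{w', []}"] w by auto
      ultimately show ?thesis by (simp flip: power_Suc2 add: Suc_diff_Suc numeral_2_eq_2)
    qed
    finally show ?thesis by simp
  qed
  finally show ?thesis by simp
qed

text \<open>Both sides carry an extra factor \<open>half_edge_count\<close>, which avoids the exponent
  \<open>card (nodes r t) - 2\<close>, truncated for the one-node tree.\<close>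

lemma card_candidates_le:
  assumes K: "\<And>w. w \<in> nodes r t \<Longrightarrow> t w < K"
  shows "card (PiE (nodes r t) (slots b t)) * half_edge_count \<le> card (embeddings b r t) * half_edge_count +
    (card (nodes r t))\<^sup>2 * (K * (card (V b) * half_edge_count ^ (card (nodes r t) - 1)))"
proof -
  let ?N = "nodes r t"
  let ?P = "PiE ?N (slots b t)"
  let ?I = "{(w, w') \<in> ?N \<times> ?N. w \<noteq> w' \<and> w' \<noteq> []}"
  let ?S = "\<lambda>(w, w'). {x \<in> ?P. fst (x w) = fst (x w')}"
  have fin: "finite ?P" by (simp add: finite_PiE)
  have finI: "finite ?I" by (rule finite_subset[of _ "?N \<times> ?N"]) auto
  have "?P \<subseteq> embeddings b r t \<union> (\<Union>p\<in>?I. ?S p)"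
  proof
    fix x assume x: "x \<in> ?P"
    show "x \<in> embeddings b r t \<union> (\<Union>p\<in>?I. ?S p)"
    proof (cases "inj_on (\<lambda>w. fst (x w)) ?N")
      case False
      then obtain w w' where w: "w \<in> ?N" "w' \<in> ?N" "fst (x w) = fst (x w')" "w \<noteq> w'"
        by (auto simp: inj_on_def)
      show ?thesis
      \<comment> \<open>The colliding pair is ordered so that the node to be dropped is not the
        root.\<close>
      proof (cases "w' = []")
        case True
        then have "(w', w) \<in> ?I" "x \<in> ?S (w', w)" using w x by auto
        then show ?thesis by blast
      next
        case False
        then have "(w, w') \<in> ?I" "x \<in> ?S (w, w')" using w x by auto
        then show ?thesis by blast
      qed
    qed (use x in \<open>simp add: embeddings_def\<close>)
  qed
  then have "card ?P \<le> card (embeddings b r t \<union> (\<Union>p\<in>?I. ?S p))"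
    using fin finI by (intro card_mono) auto
  also have "\<dots> \<le> card (embeddings b r t) + card (\<Union>p\<in>?I. ?S p)" by (rule card_Un_le)
  also have "card (\<Union>p\<in>?I. ?S p) \<le> (\<Sum>p\<in>?I. card (?S p))" using finI by (rule card_UN_le)
  finally have "card ?P * half_edge_count \<le> (card (embeddings b r t) + (\<Sum>p\<in>?I. card (?S p))) * half_edge_count"
    by simp
  also have "\<dots> = card (embeddings b r t) * half_edge_count + (\<Sum>p\<in>?I. card (?S p) * half_edge_count)"
    by (simp add: add_mult_distrib sum_distrib_right)
  also have "(\<Sum>p\<in>?I. card (?S p) * half_edge_count) \<le>
      (\<Sum>p\<in>?I. K * (card (V b) * half_edge_count ^ (card ?N - 1)))"
  proof (intro sum_mono)
    fix p assume "p \<in> ?I"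
    then obtain w w' where "p = (w, w')" "w \<in> ?N" "w' \<in> ?N" "w \<noteq> w'" "w' \<noteq> []" by auto
    then show "card (?S p) * half_edge_count \<le> K * (card (V b) * half_edge_count ^ (card ?N - 1))"
      using card_candidates_coinciding[where b = b and w = w and w' = w', OF K] by simp
  qed
  also have "\<dots> \<le> (card ?N)\<^sup>2 * (K * (card (V b) * half_edge_count ^ (card ?N - 1)))"
    using card_mono[of "?N \<times> ?N" ?I] by (auto simp: card_cartesian_product power2_eq_square intro: mult_right_mono)
  finally show ?thesis by simp
qed

lemma card_embeddings_le: "card (embeddings b r t) \<le> card (PiE (nodes r t) (slots b t))"
  unfolding embeddings_def by (intro card_mono) (auto simp: finite_PiE)

end

section \<open>Concentration of the occurrence frequencies\<close>

text \<open>For a truncated \<open>t\<close>, the probability that the branching process truncated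
  at \<open>r\<close> is \<open>t\<close>.\<close>

definition tree_prob :: "nat pmf \<Rightarrow> nat pmf \<Rightarrow> nat \<Rightarrow> (nat list \<Rightarrow> nat) \<Rightarrow> real" where
  "tree_prob D D' r t = (\<Prod>w\<in>nodes r t. pmf (offspring_law D D' (length w)) (t w))"

locale degree_sequences =
  fixes V :: "nat \<Rightarrow> bool \<Rightarrow> 'v set" and d :: "nat \<Rightarrow> bool \<Rightarrow> 'v \<Rightarrow> nat" and D :: "bool \<Rightarrow> nat pmf"
  assumes bipartite_degrees: "bipartite_degrees (V n) (d n)"
    and card_V: "filterlim (\<lambda>n. real (card (V n b))) at_top sequentially"
    and degree_freq: "(\<lambda>n. real (card {v \<in> V n b. d n b v = k}) / real (card (V n b))) \<longlonglongrightarrow> pmf (D b) k"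
    and integrable_D: "integrable (measure_pmf (D b)) real"
    and mean_pos: "pmf_mean (D b) > 0"
    and mean_degree: "(\<lambda>n. real (\<Sum>v\<in>V n b. d n b v) / real (card (V n b))) \<longlonglongrightarrow> pmf_mean (D b)"
begin

sublocale G: bipartite_degrees "V n" "d n" for n
  by (rule bipartite_degrees)

abbreviation h :: "nat \<Rightarrow> real" where
  "h n \<equiv> real (G.half_edge_count n)"

text \<open>Both sides have the same number of half-edges, so the single scale \<open>h\<close> is
  comparable to the size of either side.\<close>

lemma half_edge_ratio: "(\<lambda>n. h n / real (card (V n b))) \<longlonglongrightarrow> pmf_mean (D b)"
proof -
  have "G.half_edge_count n = (\<Sum>v\<in>V n b. d n b v)" for n
    using G.sum_degrees by (cases b) (simp_all add: G.half_edge_count_def)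
  then show ?thesis using mean_degree[of b] by simp
qed

lemma h_at_top: "filterlim h at_top sequentially"
proof -
  have lim: "filterlim (\<lambda>n. h n / real (card (V n True)) * real (card (V n True))) at_top sequentially"
    by (rule filterlim_tendsto_pos_mult_at_top[OF half_edge_ratio mean_pos card_V])
  have ev: "\<forall>\<^sub>F n in sequentially. h n / real (card (V n True)) * real (card (V n True)) = h n"
    using filterlim_at_top_dense[THEN iffD1, OF card_V, rule_format, of 0 True] by eventually_elim auto
  show ?thesis using lim unfolding filterlim_cong[OF refl refl ev] .
qed

lemma eventually_pos: "\<forall>\<^sub>F n in sequentially. h n > 0 \<and> real (card (V n b)) > 0"
  using filterlim_at_top_dense[THEN iffD1, OF card_V, rule_format, of 0 b]
    filterlim_at_top_dense[THEN iffD1, OF h_at_top, rule_format, of 0]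
  by eventually_elim simp

lemma slots_limit:
  assumes "w \<noteq> []"
  shows "(\<lambda>n. real (card (G.slots n b t w)) / h n)
    \<longlonglongrightarrow> pmf (offspring_law (D b) (D (\<not> b)) (length w)) (t w)"
proof -
  let ?s = "side b w"
  have "(\<lambda>n. real (Suc (t w)) * (real (card {v \<in> V n ?s. d n ?s v = Suc (t w)}) / real (card (V n ?s)))
      / (h n / real (card (V n ?s)))) \<longlonglongrightarrow> real (Suc (t w)) * pmf (D ?s) (Suc (t w)) / pmf_mean (D ?s)"
    using mean_pos[of ?s] by (intro tendsto_intros degree_freq half_edge_ratio) simp
  moreover have "\<forall>\<^sub>F n in sequentially.
      real (Suc (t w)) * (real (card {v \<in> V n ?s. d n ?s v = Suc (t w)}) / real (card (V n ?s)))
      / (h n / real (card (V n ?s))) = real (card (G.slots n b t w)) / h n"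
    using eventually_pos[of ?s] by eventually_elim (simp add: G.card_slots[OF assms], simp add: algebra_simps)
  ultimately have "(\<lambda>n. real (card (G.slots n b t w)) / h n)
      \<longlonglongrightarrow> real (Suc (t w)) * pmf (D ?s) (Suc (t w)) / pmf_mean (D ?s)"
    by (rule Lim_transform_eventually)
  moreover have "offspring_law (D b) (D (\<not> b)) (length w) = size_biased (D ?s)"
    using assms by (cases b) (auto simp: offspring_law_def side_def)
  ultimately show ?thesis
    using pmf_size_biased[OF integrable_D mean_pos, of ?s "t w"] by simp
qed

text \<open>Without the injectivity requirement the count factorises over the nodes and converges
  factor by factor: the root is scaled by \<open>card (V n b)\<close>, every other node by
  \<open>h\<close>. Collisions change the quotient by at most \<open>C / h n\<close>.\<close>

lemma embeddings_limit:
  "(\<lambda>n. real (card (G.embeddings n b r t)) / (real (card (V n b)) * h n ^ (card (nodes r t) - 1)))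
    \<longlonglongrightarrow> tree_prob (D b) (D (\<not> b)) r t"
proof -
  let ?N = "nodes r t" let ?m = "card ?N - 1"
  let ?P = "\<lambda>n. real (card (PiE ?N (G.slots n b t))) / (real (card (V n b)) * h n ^ ?m)"
  have N: "?N = insert [] (?N - {[]})" by auto
  have "(\<lambda>n. real (card (G.slots n b t [])) / real (card (V n b)) *
      (\<Prod>w\<in>?N - {[]}. real (card (G.slots n b t w)) / h n)) \<longlonglongrightarrow> tree_prob (D b) (D (\<not> b)) r t"
  proof -
    have eq: "tree_prob (D b) (D (\<not> b)) r t = pmf (D b) (t []) *
        (\<Prod>w\<in>?N - {[]}. pmf (offspring_law (D b) (D (\<not> b)) (length w)) (t w))"
      unfolding tree_prob_def by (subst N, subst prod.insert) (auto simp: offspring_law_def)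
    show ?thesis
      unfolding eq G.card_slots_Nil by (intro tendsto_mult degree_freq tendsto_prod slots_limit) auto
  qed
  moreover have "real (card (G.slots n b t [])) / real (card (V n b)) *
      (\<Prod>w\<in>?N - {[]}. real (card (G.slots n b t w)) / h n) = ?P n" for n
  proof -
    have "card (PiE ?N (G.slots n b t)) = card (G.slots n b t []) * (\<Prod>w\<in>?N - {[]}. card (G.slots n b t w))"
      unfolding card_PiE[OF finite_nodes] by (subst N, subst prod.insert) auto
    then show ?thesis
      by (simp add: prod_dividef)
  qed
  ultimately have P: "?P \<longlonglongrightarrow> tree_prob (D b) (D (\<not> b)) r t" by simp
  define K where "K = Suc (Max (t ` ?N))"
  have K: "t w < K" if "w \<in> ?N" for w using that by (simp add: K_def less_Suc_eq_le)
  define C where "C = real ((card ?N)\<^sup>2 * K)"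
  have "(\<lambda>n. C / h n) \<longlonglongrightarrow> 0"
    by (rule tendsto_divide_0[OF tendsto_const filterlim_at_top_imp_at_infinity[OF h_at_top]])
  from tendsto_diff[OF P this] have L: "(\<lambda>n. ?P n - C / h n) \<longlonglongrightarrow> tree_prob (D b) (D (\<not> b)) r t"
    by simp
  show ?thesis
  proof (rule tendsto_sandwich[OF _ _ L P])
    show "\<forall>\<^sub>F n in sequentially.
        ?P n - C / h n \<le> real (card (G.embeddings n b r t)) / (real (card (V n b)) * h n ^ ?m)"
      using eventually_pos[of b]
    proof eventually_elim
      case (elim n)
      let ?v = "real (card (V n b))" and ?E = "real (card (G.embeddings n b r t))"
      let ?C = "real (card (PiE ?N (G.slots n b t)))"
      have "real (card (PiE ?N (G.slots n b t)) * G.half_edge_count n) \<le>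
          real (card (G.embeddings n b r t) * G.half_edge_count n +
            (card ?N)\<^sup>2 * (K * (card (V n b) * G.half_edge_count n ^ ?m)))"
        unfolding of_nat_le_iff by (rule G.card_candidates_le[OF K])
      then have "?C * h n \<le> ?E * h n + C * (?v * h n ^ ?m)"
        by (simp add: C_def algebra_simps)
      then have "?C * h n / (?v * h n ^ ?m * h n) \<le> (?E * h n + C * (?v * h n ^ ?m)) / (?v * h n ^ ?m * h n)"
        using elim by (intro divide_right_mono) auto
      also have "\<dots> = ?E / (?v * h n ^ ?m) + C / h n"
        using elim by (auto simp: add_divide_distrib)
      finally show ?case using elim by auto
    qed
    show "\<forall>\<^sub>F n in sequentially. real (card (G.embeddings n b r t)) / (real (card (V n b)) * h n ^ ?m) \<le> ?P n"
      using G.card_embeddings_le by (intro always_eventually allI divide_right_mono) auto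
  qed
qed

lemma occurrences_tendsto:
  assumes t: "t \<in> range (trunc r)"
  shows "tendsto_in_prob (\<lambda>n. pmf_of_set (G.all_matchings n))
    (\<lambda>n \<omega>. real (card (G.occurrences n b r t \<omega>)) / real (card (V n b))) (tree_prob (D b) (D (\<not> b)) r t)"
proof -
  let ?N = "nodes r t" let ?m = "card ?N - 1" and ?q = "tree_prob (D b) (D (\<not> b)) r t"
  let ?v = "\<lambda>n. real (card (V n b))"
  \<comment> \<open>With \<open>m\<close> edges, \<open>A\<close> is the number of placements
    relative to its natural scale, and \<open>R k\<close> compares \<open>(h - k)! / h!\<close> with
    \<open>1 / h ^ k\<close>. The mean frequency is \<open>A * R m\<close>; the second moment is at
    most \<open>A^2 * R (2 m) + C / v\<close>, the last term coming from overlapping pairs.\<close>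
  define A where "A n = real (card (G.embeddings n b r t)) / (?v n * h n ^ ?m)" for n
  define R where "R k n = h n ^ k * fact (G.half_edge_count n - k) / fact (G.half_edge_count n)" for k n
  define K where "K = Suc (Max (t ` ?N))"
  have K: "t w < K" if "w \<in> ?N" for w using that by (simp add: K_def less_Suc_eq_le)
  define C where "C = real ((card ?N)\<^sup>2 * K ^ r)"
  have A: "A \<longlonglongrightarrow> ?q" unfolding A_def[abs_def] by (rule embeddings_limit)
  have "filterlim G.half_edge_count at_top sequentially"
    using h_at_top by (simp add: filterlim_sequentially_iff_filterlim_real)
  then have R: "R k \<longlonglongrightarrow> 1" for k
    unfolding R_def[abs_def] by (rule filterlim_compose[OF falling_factorial_asymp])
  have M: "G.all_matchings n \<noteq> {}" "finite (G.all_matchings n)" for n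
    using G.card_all_matchings[of n] by (auto simp: card_eq_0_iff[of "G.all_matchings n"] simp del: fact_nonzero)
      (metis card.empty fact_nonzero)
  note E = integral_pmf_of_set[OF M]
  have "(\<lambda>n. A n * R ?m n) \<longlonglongrightarrow> ?q * 1" by (intro tendsto_mult A R)
  moreover have "\<forall>\<^sub>F n in sequentially. A n * R ?m n = measure_pmf.expectation (pmf_of_set (G.all_matchings n))
      (\<lambda>\<omega>. real (card (G.occurrences n b r t \<omega>)) / ?v n)"
    using eventually_pos[of b]
  proof eventually_elim
    case (elim n)
    have "(\<Sum>\<omega>\<in>G.all_matchings n. real (card (G.occurrences n b r t \<omega>))) =
        real (card (G.embeddings n b r t)) * fact (G.half_edge_count n - ?m)"
      unfolding of_nat_sum[symmetric] G.sum_card_occurrences by simp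
    then show ?case
      using elim by (simp add: E A_def R_def G.card_all_matchings flip: sum_divide_distrib)
  qed
  ultimately have mean: "(\<lambda>n. measure_pmf.expectation (pmf_of_set (G.all_matchings n))
      (\<lambda>\<omega>. real (card (G.occurrences n b r t \<omega>)) / ?v n)) \<longlonglongrightarrow> ?q"
    using Lim_transform_eventually by fastforce
  show ?thesis
  proof (rule tendsto_in_prob_second_moment[OF _ mean])
    show "\<forall>\<^sub>F n in sequentially. measure_pmf.expectation (pmf_of_set (G.all_matchings n))
        (\<lambda>\<omega>. (real (card (G.occurrences n b r t \<omega>)) / ?v n)\<^sup>2) \<le> (A n)\<^sup>2 * R (2 * ?m) n + C / ?v n"
      using eventually_pos[of b]
    proof eventually_elim
      case (elim n)
      let ?F = "fact (G.half_edge_count n) :: real" and ?e = "real (card (G.embeddings n b r t))"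
      have "real (\<Sum>\<omega>\<in>G.all_matchings n. (card (G.occurrences n b r t \<omega>))\<^sup>2) \<le>
          real ((card (G.embeddings n b r t))\<^sup>2 * fact (G.half_edge_count n - 2 * ?m) +
            fact (G.half_edge_count n) * (card (V n b) * ((card ?N)\<^sup>2 * K ^ r)))"
        unfolding of_nat_le_iff by (rule G.sum_card_occurrences_sq[OF t K])
      then have "(\<Sum>\<omega>\<in>G.all_matchings n. (real (card (G.occurrences n b r t \<omega>)))\<^sup>2) \<le>
          ?e\<^sup>2 * fact (G.half_edge_count n - 2 * ?m) + ?F * (?v n * C)"
        by (simp add: C_def)
      then have "(\<Sum>\<omega>\<in>G.all_matchings n. (real (card (G.occurrences n b r t \<omega>)))\<^sup>2) / ((?v n)\<^sup>2 * ?F) \<le>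
          (?e\<^sup>2 * fact (G.half_edge_count n - 2 * ?m) + ?F * (?v n * C)) / ((?v n)\<^sup>2 * ?F)"
        by (intro divide_right_mono) auto
      also have "\<dots> = (A n)\<^sup>2 * R (2 * ?m) n + C / ?v n"
        unfolding A_def R_def mult_2 power_add using elim
        by (auto simp: add_divide_distrib power2_eq_square)
      finally show ?case
        by (simp add: E G.card_all_matchings power_divide mult.commute flip: sum_divide_distrib)
    qed
    have "(\<lambda>n. (A n)\<^sup>2 * R (2 * ?m) n + C / ?v n) \<longlonglongrightarrow> ?q\<^sup>2 * 1 + 0"
      by (intro tendsto_add tendsto_mult tendsto_power A R
          tendsto_divide_0[OF tendsto_const filterlim_at_top_imp_at_infinity[OF card_V]])
    then show "(\<lambda>n. (A n)\<^sup>2 * R (2 * ?m) n + C / ?v n) \<longlonglongrightarrow> ?q\<^sup>2" by simp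
  qed (simp add: M)
qed

end

section \<open>The law of the truncated branching process\<close>

lemma space_BP [simp]: "space (BP D D') = UNIV"
  by (simp add: BP_def space_PiM)

lemma prob_space_BP: "prob_space (BP D D')"
  unfolding BP_def by (intro prob_space_PiM prob_space_measure_pmf)

lemma sets_BP_cong: "sets (BP D D') = sets (BP E E')"
  unfolding BP_def by (intro sets_PiM_cong) simp_all

lemma
  assumes t: "t \<in> range (trunc r)"
  shows sets_BP_trunc_eq: "{\<xi>. trunc r \<xi> = t} \<in> sets (BP D D')"
    and measure_BP_trunc_eq: "measure (BP D D') {\<xi>. trunc r \<xi> = t} = tree_prob D D' r t"
proof -
  interpret product_prob_space "\<lambda>u. measure_pmf (offspring_law D D' (length u))" "UNIV :: nat list set"
    by unfold_locales
  have eq: "{\<xi>. trunc r \<xi> = t} = emb UNIV (nodes r t) (PiE (nodes r t) (\<lambda>w. {t w}))"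
    by (auto simp: prod_emb_def trunc_eq_iff[OF t] PiE_iff restrict_def extensional_def)
  show "{\<xi>. trunc r \<xi> = t} \<in> sets (BP D D')"
    unfolding BP_def eq by (rule sets_PiM_I) simp_all
  show "measure (BP D D') {\<xi>. trunc r \<xi> = t} = tree_prob D D' r t"
    unfolding BP_def eq tree_prob_def by (subst measure_PiM_emb) (simp_all add: pmf.rep_eq)
qed

text \<open>Countability makes every property of the truncation an event, so measurability of the
  isomorphism relation is never an issue.\<close>

lemma sets_BP_trunc: "{\<xi>. trunc r \<xi> \<in> S} \<in> sets (BP D D')"
proof -
  have "{\<xi>. trunc r \<xi> \<in> S} = (\<Union>t\<in>S \<inter> range (trunc r). {\<xi>. trunc r \<xi> = t})" by auto
  also have "\<dots> \<in> sets (BP D D')"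
    using countable_subset[OF _ countable_range_trunc[of r], of "S \<inter> range (trunc r)"]
    by (intro sets.countable_UN') (auto intro: sets_BP_trunc_eq)
  finally show ?thesis .
qed

lemma measure_BP_trunc_finite:
  assumes "finite F" "F \<subseteq> range (trunc r)"
  shows "measure (BP D D') {\<xi>. trunc r \<xi> \<in> F} = (\<Sum>t\<in>F. tree_prob D D' r t)"
proof -
  interpret prob_space "BP D D'" by (rule prob_space_BP)
  have "{\<xi>. trunc r \<xi> \<in> F} = (\<Union>t\<in>F. {\<xi>. trunc r \<xi> = t})" by auto
  then have "measure (BP D D') {\<xi>. trunc r \<xi> \<in> F} = (\<Sum>t\<in>F. measure (BP D D') {\<xi>. trunc r \<xi> = t})"
    using assms by (simp, intro finite_measure_finite_Union)
      (auto simp: disjoint_family_on_def intro: sets_BP_trunc_eq)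
  also have "\<dots> = (\<Sum>t\<in>F. tree_prob D D' r t)"
    using assms by (intro sum.cong) (auto intro: measure_BP_trunc_eq)
  finally show ?thesis .
qed

lemma finite_trunc_approx:
  assumes "\<epsilon> > 0"
  obtains F where "finite F" "F \<subseteq> range (trunc r)" "(\<Sum>t\<in>F. tree_prob D D' r t) > 1 - \<epsilon>"
proof -
  interpret prob_space "BP D D'" by (rule prob_space_BP)
  let ?R = "range (trunc r)"
  let ?F = "\<lambda>n. from_nat_into ?R ` {..n}"
  have R: "?F n \<subseteq> ?R" for n using range_from_nat_into_subset[of ?R] by auto
  have "(\<lambda>n. measure (BP D D') {\<xi>. trunc r \<xi> \<in> ?F n}) \<longlonglongrightarrow> measure (BP D D') (\<Union>n. {\<xi>. trunc r \<xi> \<in> ?F n})"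
    by (rule finite_Lim_measure_incseq) (auto simp: sets_BP_trunc incseq_def)
  also have "(\<Union>n. {\<xi>. trunc r \<xi> \<in> ?F n}) = space (BP D D')"
  proof -
    have "\<exists>n. trunc r \<xi> \<in> ?F n" for \<xi>
    proof -
      obtain n where "from_nat_into ?R n = trunc r \<xi>"
        using from_nat_into_surj[OF countable_range_trunc[of r], of "trunc r \<xi>"] by blast
      then have "trunc r \<xi> \<in> ?F n" by (metis atMost_iff imageI order_refl)
      then show ?thesis ..
    qed
    then show ?thesis by auto
  qed
  finally have "(\<lambda>n. measure (BP D D') {\<xi>. trunc r \<xi> \<in> ?F n}) \<longlonglongrightarrow> 1"
    unfolding prob_space .
  then have "\<forall>\<^sub>F n in sequentially. measure (BP D D') {\<xi>. trunc r \<xi> \<in> ?F n} > 1 - \<epsilon>"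
    by (rule order_tendstoD) (use assms in simp)
  then obtain n where "measure (BP D D') {\<xi>. trunc r \<xi> \<in> ?F n} > 1 - \<epsilon>"
    using eventually_happens' sequentially_bot by blast
  then show ?thesis
    using measure_BP_trunc_finite[OF _ R] by (intro that[of "?F n"] R) auto
qed

text \<open>Clearing the denominator in \<gamma> puts the weights in a symmetric form, the one in
  which the limiting proportions of the two sides appear.\<close>

lemma measure_BP_s:
  assumes A: "A \<in> sets (BP Dl Dr)" and pos: "pmf_mean Dl > 0" "pmf_mean Dr > 0"
  shows "measure (BP_s Dl Dr) A = pmf_mean Dr / (pmf_mean Dl + pmf_mean Dr) * measure (BP Dl Dr) A +
    pmf_mean Dl / (pmf_mean Dl + pmf_mean Dr) * measure (BP Dr Dl) A"
proof -
  define p where "p = pmf_mean Dl / pmf_mean Dr / (1 + pmf_mean Dl / pmf_mean Dr)"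
  have p: "p = pmf_mean Dl / (pmf_mean Dl + pmf_mean Dr)" "1 - p = pmf_mean Dr / (pmf_mean Dl + pmf_mean Dr)"
    using pos by (simp_all add: p_def field_simps)
  have p01: "0 \<le> p" "p \<le> 1" unfolding p(1) using pos by simp_all
  let ?N = "\<lambda>b. if b then BP Dr Dl else BP Dl Dr"
  have "?N b \<in> space (subprob_algebra (BP Dl Dr))" for b
    using prob_space_BP sets_BP_cong[of Dr Dl Dl Dr]
    by (auto simp: space_subprob_algebra prob_space_imp_subprob_space)
  then have "?N \<in> measure_pmf (bernoulli_pmf p) \<rightarrow>\<^sub>M subprob_algebra (BP Dl Dr)"
    by (simp add: measurable_def)
  from measure_pmf.measure_bind[OF this A]
  have "measure (BP_s Dl Dr) A = measure_pmf.expectation (bernoulli_pmf p) (\<lambda>b. measure (?N b) A)"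
    unfolding BP_s_def BP_l_def BP_r_def p_def Let_def .
  also have "\<dots> = measure (BP Dr Dl) A * p + measure (BP Dl Dr) A * (1 - p)"
    using p01 by simp
  finally show ?thesis using p by (simp add: mult.commute)
qed

lemma space_BP_s: "space (BP_s Dl Dr) = UNIV"
proof -
  have "sets (BP_s Dl Dr) = sets (BP Dl Dr)"
    unfolding BP_s_def BP_l_def BP_r_def Let_def
    by (rule sets_bind) (simp_all add: sets_BP_cong[of Dr Dl Dl Dr])
  from sets_eq_imp_space_eq[OF this] show ?thesis by simp
qed

section \<open>Convergence in probability by approximation, and convergence of point masses\<close>

lemma tendsto_in_prob_map_pmf:
  "tendsto_in_prob (\<lambda>n. map_pmf (f n) (p n)) X c \<longleftrightarrow> tendsto_in_prob p (\<lambda>n x. X n (f n x)) c"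
  by (simp add: tendsto_in_prob_def vimage_def)

text \<open>A union bound over finitely many bad events reduces convergence in probability to a
  deterministic estimate. It serves twice: for finitely many trees, and for the two sides of the
  graph.\<close>

lemma tendsto_in_prob_approx:
  fixes Y :: "'i \<Rightarrow> nat \<Rightarrow> 'a \<Rightarrow> real"
  assumes "\<And>\<epsilon>. \<epsilon> > 0 \<Longrightarrow> \<exists>F \<delta>. finite F \<and> \<delta> > 0 \<and> (\<forall>i\<in>F. tendsto_in_prob p (Y i) (c i)) \<and>
    (\<forall>\<^sub>F n in sequentially. \<forall>x\<in>set_pmf (p n). (\<forall>i\<in>F. \<bar>Y i n x - c i\<bar> \<le> \<delta>) \<longrightarrow> \<bar>X n x - l\<bar> \<le> \<epsilon>)"
  shows "tendsto_in_prob p X l"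
  unfolding tendsto_in_prob_def
proof (intro allI impI)
  fix \<epsilon> :: real assume "\<epsilon> > 0"
  from assms[OF this] obtain F \<delta> where F: "finite F" "\<delta> > 0"
    "\<And>i. i \<in> F \<Longrightarrow> tendsto_in_prob p (Y i) (c i)"
    "\<forall>\<^sub>F n in sequentially. \<forall>x\<in>set_pmf (p n). (\<forall>i\<in>F. \<bar>Y i n x - c i\<bar> \<le> \<delta>) \<longrightarrow> \<bar>X n x - l\<bar> \<le> \<epsilon>"
    by blast
  let ?B = "\<lambda>i n. {x. \<bar>Y i n x - c i\<bar> > \<delta>}"
  have le: "\<forall>\<^sub>F n in sequentially. measure_pmf.prob (p n) {x. \<bar>X n x - l\<bar> > \<epsilon>} \<le>
      (\<Sum>i\<in>F. measure_pmf.prob (p n) (?B i n))"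
    using F(4)
  proof eventually_elim
    case (elim n)
    have "measure_pmf.prob (p n) {x. \<bar>X n x - l\<bar> > \<epsilon>} =
        measure_pmf.prob (p n) ({x. \<bar>X n x - l\<bar> > \<epsilon>} \<inter> set_pmf (p n))"
      by (simp add: measure_Int_set_pmf)
    also have "\<dots> \<le> measure_pmf.prob (p n) (\<Union>i\<in>F. ?B i n)"
      using elim by (intro measure_pmf.finite_measure_mono) (auto simp: not_less[symmetric])
    also have "\<dots> \<le> (\<Sum>i\<in>F. measure_pmf.prob (p n) (?B i n))"
      using F(1) by (intro measure_pmf.finite_measure_subadditive_finite) auto
    finally show ?case .
  qed
  have "(\<lambda>n. \<Sum>i\<in>F. measure_pmf.prob (p n) (?B i n)) \<longlonglongrightarrow> (\<Sum>i\<in>F. 0)"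
    using F(2,3) by (intro tendsto_sum) (auto simp: tendsto_in_prob_def)
  then have lim: "(\<lambda>n. \<Sum>i\<in>F. measure_pmf.prob (p n) (?B i n)) \<longlonglongrightarrow> 0" by simp
  show "(\<lambda>n. measure_pmf.prob (p n) {x. \<bar>X n x - l\<bar> > \<epsilon>}) \<longlonglongrightarrow> 0"
    by (rule tendsto_sandwich[OF _ le tendsto_const lim]) simp
qed

text \<open>The limit law charges only integers, so \<open>k - 1/2\<close> and
  \<open>k + 1/2\<close> are continuity points of its distribution function, and the mass at
  \<open>k\<close> is the increment between them.\<close>

lemma weak_conv_nat_pmf:
  assumes "weak_conv_nat Dn D"
  shows "(\<lambda>n. pmf (Dn n) k) \<longlonglongrightarrow> pmf D k"
proof -
  have cdf: "cdf (distr (measure_pmf p) borel real) x = measure_pmf.prob p {j. real j \<le> x}" for p :: "nat pmf" and x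
    by (simp add: cdf_def measure_distr vimage_def)
  have lim: "(\<lambda>n. measure_pmf.prob (Dn n) {j. real j \<le> x}) \<longlonglongrightarrow> measure_pmf.prob D {j. real j \<le> x}"
    if "x \<notin> range real" for x
  proof -
    interpret real_distribution "distr (measure_pmf D) borel real"
      by (rule prob_space.real_distribution_distr[OF prob_space_measure_pmf]) simp
    have "measure (distr (measure_pmf D) borel real) {x} = 0"
      using that by (subst measure_distr) (auto simp: vimage_def intro!: measure_pmf.prob_eq_0[THEN iffD2])
    then have "isCont (cdf (distr (measure_pmf D) borel real)) x" by (simp add: isCont_cdf)
    then show ?thesis
      using assms by (simp add: weak_conv_nat_def weak_conv_m_def weak_conv_def cdf)
  qed
  have half: "real k - 1/2 \<notin> range real" "real k + 1/2 \<notin> range real"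
  proof -
    have "real k + 1/2 \<noteq> real j" "real k - 1/2 \<noteq> real j" for j
    proof -
      have "real (2 * k + 1) \<noteq> real (2 * j)" "real (2 * k) \<noteq> real (2 * j + 1)"
        unfolding of_nat_eq_iff by presburger+
      then show "real k + 1/2 \<noteq> real j" "real k - 1/2 \<noteq> real j" by auto
    qed
    then show "real k - 1/2 \<notin> range real" "real k + 1/2 \<notin> range real" by auto
  qed
  have "measure_pmf.prob p {j. real j \<le> real k + 1/2} - measure_pmf.prob p {j. real j \<le> real k - 1/2} = pmf p k" for p
  proof -
    have "real j \<le> real k + 1/2 \<longleftrightarrow> j = k \<or> real j \<le> real k - 1/2" for j
      by (cases j k rule: linorder_cases) (auto simp: nat_less_real_le)
    then have "{j. real j \<le> real k + 1/2} = {k} \<union> {j. real j \<le> real k - 1/2}" by auto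
    also have "measure_pmf.prob p \<dots> = pmf p k + measure_pmf.prob p {j. real j \<le> real k - 1/2}"
      by (subst measure_pmf.finite_measure_Union) (auto simp: measure_pmf_single)
    finally show ?thesis by simp
  qed
  then show ?thesis using tendsto_diff[OF lim[OF half(2)] lim[OF half(1)]] by simp
qed

section \<open>Local convergence\<close>

lemma (in bipartite_degrees) rooted_ball_occurrence_iff:
  assumes "\<omega> \<in> all_matchings" "x \<in> occurrences b r t \<omega>"
  shows "rooted_ball r (graph \<omega>, fst (x [])) \<simeq> Z \<longleftrightarrow> tree_ball r t \<simeq> Z"
proof -
  have iso: "tree_ball r t \<simeq> rooted_ball r (graph \<omega>, fst (x []))"
    using assms by (rule tree_ball_occurrence)
  moreover have "rooted_ball r (graph \<omega>, fst (x [])) \<simeq> tree_ball r t"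
    using iso by (rule rooted_iso_sym[OF mgraph_tree_ball]) (simp add: tree_ball_def)
  ultimately show ?thesis
    by (blast intro: rooted_iso_trans)
qed

text \<open>Occurrences of different trees have different roots, so counting them never counts a
  vertex twice.\<close>

lemma (in bipartite_degrees) sum_card_occurrences_le:
  assumes \<omega>: "\<omega> \<in> all_matchings" and F: "finite F" "F \<subseteq> range (trunc r)" and U: "finite U"
    and roots: "\<And>t x. t \<in> F \<Longrightarrow> x \<in> occurrences b r t \<omega> \<Longrightarrow> fst (x []) \<in> U"
  shows "(\<Sum>t\<in>F. card (occurrences b r t \<omega>)) \<le> card U"
proof -
  have "(\<Sum>t\<in>F. card (occurrences b r t \<omega>)) = card (SIGMA t:F. occurrences b r t \<omega>)"
    using F(1) by (intro card_SigmaI[symmetric]) auto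
  also have "\<dots> \<le> card U"
  proof (rule card_inj_on_le)
    show "inj_on (\<lambda>(t, x). fst (x [])) (SIGMA t:F. occurrences b r t \<omega>)"
    proof (rule inj_onI)
      fix p p' assume p: "p \<in> (SIGMA t:F. occurrences b r t \<omega>)" "p' \<in> (SIGMA t:F. occurrences b r t \<omega>)"
        and eq: "(\<lambda>(t, x). fst (x [])) p = (\<lambda>(t, x). fst (x [])) p'"
      obtain t x t' x' where pp: "p = (t, x)" "p' = (t', x')" by force
      have tt: "t \<in> range (trunc r)" "t' \<in> range (trunc r)" using p pp F by auto
      show "p = p'"
        using occurrences_unique[OF \<omega> _ _ _ tt, of x b x'] p eq by (simp add: pp)
    qed
  qed (use U roots in auto)
  finally show ?thesis .
qed

lemma (in bipartite_degrees) occurrence_root: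
  "x \<in> occurrences b r t \<omega> \<Longrightarrow> fst (x []) \<in> V b"
  using slots_V[OF embeddingsD(1)[OF occurrencesD(1)], of x b r t \<omega> "[]"] by simp

text \<open>The trees of a finite set \<open>F\<close> bound from below both the class of
  \<open>Z\<close> and its complement, once for the empirical frequency and once for the branching
  process. The two squeezes leave only the mass missing from \<open>F\<close>.\<close>

lemma (in degree_sequences) ball_frequency:
  fixes Z :: "('a, 'b) mgraph \<times> 'a"
  shows "tendsto_in_prob (\<lambda>n. pmf_of_set (G.all_matchings n))
    (\<lambda>n \<omega>. real (card {u \<in> V n b. rooted_ball r (G.graph n \<omega>, u) \<simeq> Z}) / real (card (V n b)))
    (measure (BP (D b) (D (\<not> b))) {\<xi>. tree_ball r \<xi> \<simeq> Z})"
proof (rule tendsto_in_prob_approx[where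
      Y = "\<lambda>t n \<omega>. real (card (G.occurrences n b r t \<omega>)) / real (card (V n b))" and
      c = "tree_prob (D b) (D (\<not> b)) r"])
  fix \<epsilon> :: real assume \<epsilon>: "\<epsilon> > 0"
  let ?P = "BP (D b) (D (\<not> b))" and ?q = "tree_prob (D b) (D (\<not> b)) r"
  let ?Y = "\<lambda>t n \<omega>. real (card (G.occurrences n b r t \<omega>)) / real (card (V n b))"
  let ?X = "\<lambda>n \<omega>. real (card {u \<in> V n b. rooted_ball r (G.graph n \<omega>, u) \<simeq> Z}) / real (card (V n b))"
  let ?p = "measure ?P {\<xi>. tree_ball r \<xi> \<simeq> Z}"
  interpret P: prob_space ?P by (rule prob_space_BP)
  obtain F where F: "finite F" "F \<subseteq> range (trunc r)" "(\<Sum>t\<in>F. ?q t) > 1 - \<epsilon> / 3"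
    using finite_trunc_approx[where r = r and D = "D b" and D' = "D (\<not> b)" and \<epsilon> = "\<epsilon> / 3"] \<epsilon>
    by (metis divide_pos_pos zero_less_numeral)
  \<comment> \<open>Chosen so that errors of size \<delta> for all trees of \<open>F\<close> add up
    to at most a third of \<epsilon>; the summand 1 covers an empty \<open>F\<close>.\<close>
  define \<delta> where "\<delta> = \<epsilon> / (3 * (real (card F) + 1))"
  have \<delta>: "\<delta> > 0" "real (card F) * \<delta> \<le> \<epsilon> / 3"
    using \<epsilon> by (auto simp: \<delta>_def field_simps)
  define FZ where "FZ = {t \<in> F. tree_ball r t \<simeq> Z}"
  have FZ: "finite FZ" "FZ \<subseteq> F" "FZ \<subseteq> range (trunc r)" "F - FZ \<subseteq> range (trunc r)"
    using F by (auto simp: FZ_def)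
  have sets: "{\<xi>. trunc r \<xi> \<in> S} \<in> P.events" for S by (rule sets_BP_trunc)
  define S where "S = {t. tree_ball r t \<simeq> Z}"
  have eq: "{\<xi>. tree_ball r \<xi> \<simeq> Z} = {\<xi>. trunc r \<xi> \<in> S}" by (simp add: S_def)
  have qF: "(\<Sum>t\<in>F. ?q t) = (\<Sum>t\<in>FZ. ?q t) + (\<Sum>t\<in>F - FZ. ?q t)"
    using sum.subset_diff[OF FZ(2) F(1), of ?q] by (simp only: add.commute)
  have lower: "(\<Sum>t\<in>FZ. ?q t) \<le> ?p"
    unfolding measure_BP_trunc_finite[OF FZ(1,3), symmetric] eq
    by (intro P.finite_measure_mono sets) (auto simp: FZ_def S_def)
  have upper: "?p + (\<Sum>t\<in>F - FZ. ?q t) \<le> 1"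
  proof -
    have "?p + (\<Sum>t\<in>F - FZ. ?q t) = ?p + measure ?P {\<xi>. trunc r \<xi> \<in> F - FZ}"
      using measure_BP_trunc_finite[of "F - FZ" r] F(1) FZ(4) by simp
    also have "\<dots> = measure ?P ({\<xi>. tree_ball r \<xi> \<simeq> Z} \<union> {\<xi>. trunc r \<xi> \<in> F - FZ})"
      unfolding eq by (intro P.finite_measure_Union[symmetric] sets) (auto simp: FZ_def S_def)
    also have "\<dots> \<le> 1" by (rule P.prob_le_1)
    finally show ?thesis .
  qed
  have "\<forall>\<^sub>F n in sequentially. \<forall>\<omega>\<in>set_pmf (pmf_of_set (G.all_matchings n)).
      (\<forall>t\<in>F. \<bar>?Y t n \<omega> - ?q t\<bar> \<le> \<delta>) \<longrightarrow> \<bar>?X n \<omega> - ?p\<bar> \<le> \<epsilon>"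
    using eventually_pos[of b]
  proof eventually_elim
    case (elim n)
    show ?case
    proof (intro ballI impI)
      fix \<omega> assume "\<omega> \<in> set_pmf (pmf_of_set (G.all_matchings n))"
        and close: "\<forall>t\<in>F. \<bar>?Y t n \<omega> - ?q t\<bar> \<le> \<delta>"
      moreover have "G.all_matchings n \<noteq> {}"
        using G.card_all_matchings[of n] by (metis card.empty fact_nonzero)
      ultimately have \<omega>: "\<omega> \<in> G.all_matchings n" by simp
      let ?v = "real (card (V n b))"
      let ?U = "{u \<in> V n b. rooted_ball r (G.graph n \<omega>, u) \<simeq> Z}"
      have Ysum: "(\<Sum>t\<in>F'. ?q t) - \<epsilon> / 3 \<le> (\<Sum>t\<in>F'. ?Y t n \<omega>)" if "F' \<subseteq> F" for F'
      proof -
        have "(\<Sum>t\<in>F'. ?q t - \<delta>) \<le> (\<Sum>t\<in>F'. ?Y t n \<omega>)"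
          using close that by (intro sum_mono) fastforce
        moreover have "real (card F') * \<delta> \<le> real (card F) * \<delta>"
          using card_mono[OF F(1) that] \<delta>(1) by (intro mult_right_mono) auto
        ultimately show ?thesis using \<delta>(2) by (simp add: sum_subtractf)
      qed
      have "(\<Sum>t\<in>FZ. card (G.occurrences n b r t \<omega>)) \<le> card ?U"
      proof (rule G.sum_card_occurrences_le[OF \<omega> FZ(1,3)])
        show "fst (x []) \<in> ?U" if "t \<in> FZ" "x \<in> G.occurrences n b r t \<omega>" for t x
          using that G.occurrence_root[OF that(2)] G.rooted_ball_occurrence_iff[OF \<omega> that(2), of Z]
          by (simp add: FZ_def)
      qed simp
      then have "real (\<Sum>t\<in>FZ. card (G.occurrences n b r t \<omega>)) / ?v \<le> real (card ?U) / ?v"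
        by (intro divide_right_mono) (simp_all only: of_nat_le_iff of_nat_0_le_iff)
      then have 1: "(\<Sum>t\<in>FZ. ?Y t n \<omega>) \<le> ?X n \<omega>"
        by (simp add: sum_divide_distrib)
      have "(\<Sum>t\<in>F - FZ. card (G.occurrences n b r t \<omega>)) \<le> card (V n b - ?U)"
      proof (rule G.sum_card_occurrences_le[OF \<omega> _ FZ(4)])
        show "fst (x []) \<in> V n b - ?U" if "t \<in> F - FZ" "x \<in> G.occurrences n b r t \<omega>" for t x
          using that G.occurrence_root[OF that(2)] G.rooted_ball_occurrence_iff[OF \<omega> that(2), of Z]
          by (simp add: FZ_def)
      qed (use F in simp_all)
      also have "card (V n b - ?U) = card (V n b) - card ?U"
        by (intro card_Diff_subset) auto
      finally have "real (\<Sum>t\<in>F - FZ. card (G.occurrences n b r t \<omega>)) \<le> ?v - real (card ?U)"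
        using card_mono[of "V n b" ?U] by (simp add: of_nat_diff[symmetric] del: of_nat_sum of_nat_diff)
      then have "real (\<Sum>t\<in>F - FZ. card (G.occurrences n b r t \<omega>)) / ?v \<le> (?v - real (card ?U)) / ?v"
        by (intro divide_right_mono) simp_all
      then have 2: "(\<Sum>t\<in>F - FZ. ?Y t n \<omega>) \<le> 1 - ?X n \<omega>"
        using elim by (auto simp: sum_divide_distrib diff_divide_distrib split: if_splits)
      \<comment> \<open>In either direction the loss is the mass outside \<open>F\<close> plus the
        error of replacing \<open>?q\<close> by \<open>?Y\<close>, each at most a third of
        \<epsilon>.\<close>
      show "\<bar>?X n \<omega> - ?p\<bar> \<le> \<epsilon>"
        using 1 2 Ysum[of FZ] Ysum[of "F - FZ"] FZ(2) lower upper F(3) qF by auto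
    qed
  qed
  moreover have "\<forall>t\<in>F. tendsto_in_prob (\<lambda>n. pmf_of_set (G.all_matchings n)) (?Y t) (?q t)"
    using F(2) occurrences_tendsto by blast
  ultimately show "\<exists>F \<delta>. finite F \<and> \<delta> > 0 \<and>
      (\<forall>t\<in>F. tendsto_in_prob (\<lambda>n. pmf_of_set (G.all_matchings n)) (?Y t) (?q t)) \<and>
      (\<forall>\<^sub>F n in sequentially. \<forall>\<omega>\<in>set_pmf (pmf_of_set (G.all_matchings n)).
        (\<forall>t\<in>F. \<bar>?Y t n \<omega> - ?q t\<bar> \<le> \<delta>) \<longrightarrow> \<bar>?X n \<omega> - ?p\<bar> \<le> \<epsilon>)"
    using F(1) \<delta>(1) by blast
qed

section \<open>From uniform degrees to degree frequencies\<close>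

lemma unif_degree_pmf:
  assumes "finite V" "V \<noteq> {}"
  shows "pmf (unif_degree V d) k = real (card {v \<in> V. d v = k}) / real (card V)"
proof -
  have "pmf (unif_degree V d) k = measure_pmf.prob (pmf_of_set V) {v. d v = k}"
    by (simp add: unif_degree_def pmf_map vimage_def)
  also have "\<dots> = real (card (V \<inter> {v. d v = k})) / real (card V)"
    using assms by (simp add: measure_pmf_of_set)
  also have "V \<inter> {v. d v = k} = {v \<in> V. d v = k}" by auto
  finally show ?thesis .
qed

lemma unif_degree_mean:
  assumes "finite V" "V \<noteq> {}"
  shows "pmf_mean (unif_degree V d) = real (\<Sum>v\<in>V. d v) / real (card V)"
  using assms by (simp add: unif_degree_def integral_pmf_of_set)

lemma degree_sequencesI:
  fixes V :: "nat \<Rightarrow> bool \<Rightarrow> 'v set"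
  assumes "\<And>n. bipartite_degrees (V n) (d n)"
    and card: "\<And>b. filterlim (\<lambda>n. card (V n b)) at_top sequentially"
    and pos: "\<And>n b v. v \<in> V n b \<Longrightarrow> d n b v \<ge> 1"
    and conv: "\<And>b. weak_conv_nat (\<lambda>n. unif_degree (V n b) (d n b)) (D b)"
    and int: "\<And>b. integrable (measure_pmf (D b)) real"
    and mean: "\<And>b. (\<lambda>n. pmf_mean (unif_degree (V n b) (d n b))) \<longlonglongrightarrow> pmf_mean (D b)"
  shows "degree_sequences V d D"
proof
  fix n b
  interpret bipartite_degrees "V n" "d n" by (rule assms(1))
  show "finite (V n b)" by simp
  show "V n False \<inter> V n True = {}" by (rule V_disjoint)
  show "sum (d n False) (V n False) = sum (d n True) (V n True)" by (rule sum_degrees)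
next
  fix b k
  have fin: "finite (V n b)" for n
    using assms(1) by (rule bipartite_degrees.finite_V)
  have "\<forall>\<^sub>F n in sequentially. 1 \<le> card (V n b)"
    using filterlim_at_top[THEN iffD1, OF card, rule_format, of 1] .
  then have ev: "\<forall>\<^sub>F n in sequentially. V n b \<noteq> {}"
    by eventually_elim auto
  show "filterlim (\<lambda>n. real (card (V n b))) at_top sequentially"
    by (rule filterlim_compose[OF filterlim_real_sequentially card])
  show "integrable (measure_pmf (D b)) real" by (rule int)
  have "\<forall>\<^sub>F n in sequentially. pmf (unif_degree (V n b) (d n b)) k =
      real (card {v \<in> V n b. d n b v = k}) / real (card (V n b))"
    using ev by eventually_elim (rule unif_degree_pmf[OF fin])
  then show "(\<lambda>n. real (card {v \<in> V n b. d n b v = k}) / real (card (V n b))) \<longlonglongrightarrow> pmf (D b) k"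
    by (rule Lim_transform_eventually[OF weak_conv_nat_pmf[OF conv]])
  have eq: "\<forall>\<^sub>F n in sequentially. pmf_mean (unif_degree (V n b) (d n b)) =
      real (\<Sum>v\<in>V n b. d n b v) / real (card (V n b))"
    using ev by eventually_elim (rule unif_degree_mean[OF fin])
  then show lim: "(\<lambda>n. real (\<Sum>v\<in>V n b. d n b v) / real (card (V n b))) \<longlonglongrightarrow> pmf_mean (D b)"
    by (rule Lim_transform_eventually[OF mean])
  have "\<forall>\<^sub>F n in sequentially. real (\<Sum>v\<in>V n b. d n b v) / real (card (V n b)) \<ge> 1"
    using ev
  proof eventually_elim
    case (elim n)
    have "card (V n b) \<le> (\<Sum>v\<in>V n b. d n b v)"
      using sum_mono[of "V n b" "\<lambda>_. 1" "d n b"] pos by simp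
    then have "real (card (V n b)) \<le> real (\<Sum>v\<in>V n b. d n b v)" by (rule of_nat_mono)
    then show ?case using elim fin by (simp add: le_divide_eq card_gt_0_iff)
  qed
  \<comment> \<open>All degrees are at least 1, hence so are the average degree and its limit. This
    positivity gives sense to the size-biased laws and the mixture weights.\<close>
  then have "1 \<le> pmf_mean (D b)"
    by (intro tendsto_lowerbound[OF lim]) auto
  then show "pmf_mean (D b) > 0" by simp
qed

theorem theorem2p14:
  fixes Vl Vr :: "nat \<Rightarrow> 'v set"
    and dl dr :: "nat \<Rightarrow> 'v \<Rightarrow> nat"
    and Dl Dr :: "nat pmf"
    and G :: "('a, 'b) mgraph" and \<rho> :: 'a and r :: nat
  assumes "\<And>n. finite (Vl n)" and "\<And>n. finite (Vr n)" and "\<And>n. Vl n \<inter> Vr n = {}"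
    and "filterlim (\<lambda>n. card (Vl n)) at_top sequentially"
    and "filterlim (\<lambda>n. card (Vr n)) at_top sequentially"
    and "\<And>n v. v \<in> Vl n \<Longrightarrow> dl n v \<ge> 1" and "\<And>n a. a \<in> Vr n \<Longrightarrow> dr n a \<ge> 1"
    and "\<And>n. (\<Sum>v\<in>Vl n. dl n v) = (\<Sum>a\<in>Vr n. dr n a)"
    and "weak_conv_nat (\<lambda>n. unif_degree (Vl n) (dl n)) Dl"
    and "weak_conv_nat (\<lambda>n. unif_degree (Vr n) (dr n)) Dr"
    and "integrable (measure_pmf Dl) real" and "integrable (measure_pmf Dr) real"
    and "(\<lambda>n. pmf_mean (unif_degree (Vl n) (dl n))) \<longlonglongrightarrow> pmf_mean Dl"
    and "(\<lambda>n. pmf_mean (unif_degree (Vr n) (dr n))) \<longlonglongrightarrow> pmf_mean Dr"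
    and "rooted_graph (G, \<rho>)"
  shows "tendsto_in_prob (\<lambda>n. BCM (Vl n) (dl n) (Vr n) (dr n))
           (\<lambda>n H. (\<Sum>u\<in>Vl n \<union> Vr n. of_bool (rooted_ball r (H, u) \<simeq> rooted_ball r (G, \<rho>)))
                    / real (card (Vl n) + card (Vr n)))
           (\<P>(\<xi> in BP_s Dl Dr. rooted_ball r (family_tree \<xi>, []) \<simeq> rooted_ball r (G, \<rho>)))"
proof -
  define V where "V n b = (if b then Vr n else Vl n)" for n b
  define d where "d n b = (if b then dr n else dl n)" for n b
  define D where "D b = (if b then Dr else Dl)" for b
  define Z where "Z = rooted_ball r (G, \<rho>)"
  have "bipartite_degrees (V n) (d n)" for n
    using assms(1,2,3,8) by unfold_locales (auto simp: V_def d_def)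
  then have "degree_sequences V d D"
  proof (rule degree_sequencesI)
    show "d n b v \<ge> 1" if "v \<in> V n b" for n b v
      using that assms(6,7) by (simp add: V_def d_def split: if_splits)
    fix b
    show "filterlim (\<lambda>n. card (V n b)) at_top sequentially"
      using assms(4,5) by (cases b) (simp_all add: V_def)
    show "weak_conv_nat (\<lambda>n. unif_degree (V n b) (d n b)) (D b)"
      using assms(9,10) by (cases b) (simp_all add: V_def d_def D_def)
    show "integrable (measure_pmf (D b)) real"
      using assms(11,12) by (cases b) (simp_all add: D_def)
    show "(\<lambda>n. pmf_mean (unif_degree (V n b) (d n b))) \<longlonglongrightarrow> pmf_mean (D b)"
      using assms(13,14) by (cases b) (simp_all add: V_def d_def D_def)
  qed
  then interpret degree_sequences V d D .
  note [simp] = V_def d_def D_def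
  let ?M = "\<lambda>n. pmf_of_set (G.all_matchings n)"
  define X where "X b n \<omega> = real (card {u \<in> V n b. rooted_ball r (G.graph n \<omega>, u) \<simeq> Z}) / real (card (V n b))"
    for b n \<omega>
  define p where "p b = measure (BP (D b) (D (\<not> b))) {\<xi>. tree_ball r \<xi> \<simeq> Z}" for b
  have X: "tendsto_in_prob ?M (X b) (p b)" for b
    unfolding X_def[abs_def] p_def by (rule ball_frequency)
  define \<alpha> where "\<alpha> b n = real (card (V n b)) / real (card (V n False) + card (V n True))" for b n
  \<comment> \<open>The size of side \<open>b\<close> is asymptotically \<open>h\<close> divided by
    the mean degree of that side, so its proportion tends to the mean of the opposite side over the
    sum of both means.\<close>
  define a where "a b = pmf_mean (D (\<not> b)) / (pmf_mean (D False) + pmf_mean (D True))" for b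
  have \<alpha>: "\<alpha> b \<longlonglongrightarrow> a b" for b
  proof -
    let ?h = "\<lambda>b n. h n / real (card (V n b))"
    have "(\<lambda>n. ?h (\<not> b) n / (?h False n + ?h True n)) \<longlonglongrightarrow> a b"
      unfolding a_def using mean_pos[of False] mean_pos[of True]
      by (intro tendsto_intros half_edge_ratio) simp
    moreover have "\<forall>\<^sub>F n in sequentially. ?h (\<not> b) n / (?h False n + ?h True n) = \<alpha> b n"
      using eventually_pos[of False] eventually_pos[of True]
    proof eventually_elim
      case (elim n)
      have *: "x / y / (x / y + x / z) = z / (z + y)" "x / z / (x / y + x / z) = y / (z + y)"
        if "x > 0" "y > 0" "z > 0" for x y z :: real
      proof -
        have "x / y + x / z = x * (z + y) / (y * z)" using that by (simp add: field_simps)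
        then show "x / y / (x / y + x / z) = z / (z + y)" "x / z / (x / y + x / z) = y / (z + y)"
          using that by simp_all
      qed
      show ?case
        using elim *[of "h n" "real (card (V n False))" "real (card (V n True))"]
        by (cases b) (simp_all only: \<alpha>_def simp_thms of_nat_add add.commute)
    qed
    ultimately show ?thesis by (rule Lim_transform_eventually)
  qed
  define l where "l = a False * p False + a True * p True"
  have main: "tendsto_in_prob ?M (\<lambda>n \<omega>. \<alpha> False n * X False n \<omega> + \<alpha> True n * X True n \<omega>) l"
  proof (rule tendsto_in_prob_approx[where Y = X and c = p])
    fix \<epsilon> :: real assume \<epsilon>: "\<epsilon> > 0"
    have "(\<lambda>n. \<alpha> False n * p False + \<alpha> True n * p True) \<longlonglongrightarrow> l"
      unfolding l_def by (intro tendsto_intros \<alpha>)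
    then have "\<forall>\<^sub>F n in sequentially. \<bar>\<alpha> False n * p False + \<alpha> True n * p True - l\<bar> < \<epsilon> / 2"
      unfolding tendsto_iff dist_real_def using half_gt_zero[OF \<epsilon>] by blast
    then have "\<forall>\<^sub>F n in sequentially. \<forall>\<omega>\<in>set_pmf (?M n). (\<forall>b\<in>UNIV. \<bar>X b n \<omega> - p b\<bar> \<le> \<epsilon> / 2) \<longrightarrow>
        \<bar>\<alpha> False n * X False n \<omega> + \<alpha> True n * X True n \<omega> - l\<bar> \<le> \<epsilon>"
      using eventually_pos[of False]
    proof eventually_elim
      case (elim n)
      have \<alpha>0: "\<alpha> b n \<ge> 0" for b by (simp add: \<alpha>_def)
      have \<alpha>1: "\<alpha> False n + \<alpha> True n = 1"
        using elim(2) unfolding \<alpha>_def of_nat_add by (simp add: add_divide_distrib[symmetric])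
      show ?case
      proof (intro ballI impI)
        fix \<omega> assume close: "\<forall>b\<in>UNIV. \<bar>X b n \<omega> - p b\<bar> \<le> \<epsilon> / 2"
        have "\<bar>\<alpha> b n * (X b n \<omega> - p b)\<bar> \<le> \<alpha> b n * (\<epsilon> / 2)" for b
          unfolding abs_mult abs_of_nonneg[OF \<alpha>0] by (rule mult_left_mono) (use close \<alpha>0 in blast)+
        from this[of False] this[of True]
        have "\<bar>\<alpha> False n * (X False n \<omega> - p False) + \<alpha> True n * (X True n \<omega> - p True)\<bar>
            \<le> (\<alpha> False n + \<alpha> True n) * (\<epsilon> / 2)" unfolding distrib_right by linarith
        then show "\<bar>\<alpha> False n * X False n \<omega> + \<alpha> True n * X True n \<omega> - l\<bar> \<le> \<epsilon>"
          using elim(1) unfolding \<alpha>1 right_diff_distrib by linarith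
      qed
    qed
    then show "\<exists>F \<delta>. finite F \<and> \<delta> > 0 \<and> (\<forall>b\<in>F. tendsto_in_prob ?M (X b) (p b)) \<and>
        (\<forall>\<^sub>F n in sequentially. \<forall>\<omega>\<in>set_pmf (?M n). (\<forall>b\<in>F. \<bar>X b n \<omega> - p b\<bar> \<le> \<delta>) \<longrightarrow>
          \<bar>\<alpha> False n * X False n \<omega> + \<alpha> True n * X True n \<omega> - l\<bar> \<le> \<epsilon>)"
      using X \<epsilon> by (intro exI[of _ UNIV] exI[of _ "\<epsilon> / 2"]) simp
  qed
  have sum: "(\<Sum>u\<in>Vl n \<union> Vr n. of_bool (rooted_ball r (G.graph n \<omega>, u) \<simeq> Z)) / real (card (Vl n) + card (Vr n)) =
      \<alpha> False n * X False n \<omega> + \<alpha> True n * X True n \<omega>" for n \<omega>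
  proof -
    have count: "(\<Sum>u\<in>V n b. of_bool (rooted_ball r (G.graph n \<omega>, u) \<simeq> Z)) =
        real (card {u \<in> V n b. rooted_ball r (G.graph n \<omega>, u) \<simeq> Z})" for b
      using G.finite_V[of n b] by (simp only: sum_of_bool_eq Int_def mem_Collect_eq)
    have \<alpha>X: "\<alpha> b n * X b n \<omega> = real (card {u \<in> V n b. rooted_ball r (G.graph n \<omega>, u) \<simeq> Z}) /
        real (card (V n False) + card (V n True))" for b
    \<comment> \<open>For small \<open>n\<close> a side may be empty; then the weight and the count
      are both 0 and the identity survives division by zero.\<close>
    proof (cases "V n b = {}")
      case False
      then have "real (card (V n b)) \<noteq> 0" using G.finite_V[of n b] by (simp del: V_def)
      then have "real (card (V n b)) / s * (c / real (card (V n b))) = c / s" for s c by simp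
      then show ?thesis unfolding \<alpha>_def X_def .
    qed (simp only: \<alpha>_def, simp del: V_def)
    have "(\<Sum>u\<in>Vl n \<union> Vr n. of_bool (rooted_ball r (G.graph n \<omega>, u) \<simeq> Z)) =
        (\<Sum>u\<in>V n False. of_bool (rooted_ball r (G.graph n \<omega>, u) \<simeq> Z)) +
        (\<Sum>u\<in>V n True. of_bool (rooted_ball r (G.graph n \<omega>, u) \<simeq> Z) :: real)"
      by (simp only: sum.union_disjoint[OF assms(1-3)] V_def d_def if_True if_False)
    then show ?thesis
      unfolding \<alpha>X count by (simp add: add_divide_distrib)
  qed
  have "l = \<P>(\<xi> in BP_s Dl Dr. rooted_ball r (family_tree \<xi>, []) \<simeq> Z)"
  proof -
    have sets: "{\<xi>. tree_ball r \<xi> \<simeq> Z} \<in> sets (BP Dl Dr)"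
      using sets_BP_trunc[of r "{t. tree_ball r t \<simeq> Z}"] by simp
    have "l = measure (BP_s Dl Dr) {\<xi>. tree_ball r \<xi> \<simeq> Z}"
      using measure_BP_s[OF sets] mean_pos[of False] mean_pos[of True]
      by (simp add: l_def a_def p_def)
    then show ?thesis by (simp add: space_BP_s rooted_ball_family_tree)
  qed
  then show ?thesis
    using main unfolding BCM_def tendsto_in_prob_map_pmf sum[symmetric] Z_def by simp
qed

end
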